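(* Let $n \geq 2$. There exists a symplectic form $\omega$ on $S^2 \times \mathbb{R}^{2n}$ such that $\|\omega - \omega_0\|$ is finite, but $c_G(\omega) = \infty$.
   Context: The standard symplectic form $\omega_0$ on $S^2 \times \mathbb{R}^{2n}$ is the product of a symplectic form on $S^2$ of total area $1$, compatible with the integrable complex structure of $S^2=\mathbb{CP}^1$, and the standard linear symplectic form on $\mathbb{R}^{2n}$. The standard complex structure $J_0$ on $S^2 \times \mathbb{R}^{2n}$ is that of $\mathbb{CP}^1 \times \mathbb{C}^n$, and the standard metric is $g_0 = \omega_0(-,J_0-)$. For a $2$-form $\omega$ on a Riemannian manifold, its comass $\|\omega\|$ is the supremum of the values of $\omega$ over simple bivectors $v\wedge w$ of unit area; on $S^2\times\mathbb{R}^{2n}$ it is taken with respect to the standard metric $g_0$. If $(X^{2m},\omega)$ is a symplectic manifold of dimension $2m$, its Gromov width $c_G(\omega)\in[0,\infty]$ is the supremum of $\pi R^2$ over all $R>0$ such that there is a symplectic embedding of the ball $B^{2m}_R$ of radius $R$ in $(\mathbb{R}^{2m},\omega_{std})$ into $(X,\omega)$, where $\omega_{std}$ is the standard linear symplectic form. *)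

theory Defs
  imports "HOL-Analysis.Analysis"
begin

section \<open>Smooth maps\<close>

text \<open>The set \<open>S\<close> is meant to be open: derivatives are taken in the whole space.\<close>

primrec C_k_on :: "nat \<Rightarrow> 'a::real_normed_vector set \<Rightarrow> ('a \<Rightarrow> 'b::real_normed_vector) \<Rightarrow> bool" where
  "C_k_on 0 S f \<longleftrightarrow> continuous_on S f"
| "C_k_on (Suc k) S f \<longleftrightarrow>
     (\<forall>x\<in>S. f differentiable (at x)) \<and>
     (\<forall>v. C_k_on k S (\<lambda>x. frechet_derivative f (at x) v))"

definition smooth_on :: "'a::real_normed_vector set \<Rightarrow> ('a \<Rightarrow> 'b::real_normed_vector) \<Rightarrow> bool" where
  "smooth_on S f \<longleftrightarrow> (\<forall>k. C_k_on k S f)"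


section \<open>Differential 2-forms on submanifolds of a Euclidean space\<close>

text \<open>Manifolds are embedded submanifolds \<open>X\<close> of a Euclidean space.  The tangent space at a
  point of \<open>X\<close> is the set of velocities of smooth curves in \<open>X\<close> through that point.\<close>

definition tangent_space :: "'a::euclidean_space set \<Rightarrow> 'a \<Rightarrow> 'a set" where
  "tangent_space X p =
     {v. \<exists>\<gamma> e. 0 < e \<and> smooth_on {-e<..<e::real} \<gamma> \<and> \<gamma> ` {-e<..<e} \<subseteq> X \<and>
               \<gamma> 0 = p \<and> (\<gamma> has_vector_derivative v) (at 0)}"

text \<open>A 2-form on \<open>X\<close> is a function \<open>\<omega>\<close> of a point and two vectors; only its values
  \<open>\<omega> p v w\<close> with \<open>p \<in> X\<close> and \<open>v, w\<close> tangent to \<open>X\<close> at \<open>p\<close> are meaningful.\<close>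

type_synonym 'a form2 = "'a \<Rightarrow> 'a \<Rightarrow> 'a \<Rightarrow> real"

definition smooth_form2_on :: "'a::euclidean_space set \<Rightarrow> 'a form2 \<Rightarrow> bool" where
  "smooth_form2_on U \<Omega> \<longleftrightarrow>
     (\<forall>x\<in>U. bilinear (\<Omega> x) \<and> (\<forall>v. \<Omega> x v v = 0)) \<and>
     (\<forall>v w. smooth_on U (\<lambda>x. \<Omega> x v w))"

text \<open>The exterior derivative of an ambient 2-form, by the invariant formula evaluated on
  constant vector fields (whose Lie brackets vanish).\<close>

definition ext_deriv :: "'a::euclidean_space form2 \<Rightarrow> 'a \<Rightarrow> 'a \<Rightarrow> 'a \<Rightarrow> 'a \<Rightarrow> real" where
  "ext_deriv \<Omega> x u v w =
     frechet_derivative (\<lambda>y. \<Omega> y v w) (at x) u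
   - frechet_derivative (\<lambda>y. \<Omega> y u w) (at x) v
   + frechet_derivative (\<lambda>y. \<Omega> y u v) (at x) w"

definition local_extension ::
    "'a::euclidean_space set \<Rightarrow> 'a form2 \<Rightarrow> 'a set \<Rightarrow> 'a form2 \<Rightarrow> bool" where
  "local_extension X \<omega> U \<Omega> \<longleftrightarrow>
     open U \<and> smooth_form2_on U \<Omega> \<and>
     (\<forall>x\<in>X \<inter> U. \<forall>v\<in>tangent_space X x. \<forall>w\<in>tangent_space X x. \<Omega> x v w = \<omega> x v w)"

text \<open>Smoothness of a form on \<open>X\<close> means that it is locally the restriction of a smooth ambient
  form \<open>\<Omega>\<close>; its exterior derivative is then the restriction of \<open>d\<Omega>\<close> to the tangent spaces
  of \<open>X\<close>, which does not depend on \<open>\<Omega>\<close> because \<open>d\<close> commutes with pullback to \<open>X\<close>.\<close>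

definition smooth_form2 :: "'a::euclidean_space set \<Rightarrow> 'a form2 \<Rightarrow> bool" where
  "smooth_form2 X \<omega> \<longleftrightarrow> (\<forall>p\<in>X. \<exists>U \<Omega>. p \<in> U \<and> local_extension X \<omega> U \<Omega>)"

definition closed_form2 :: "'a::euclidean_space set \<Rightarrow> 'a form2 \<Rightarrow> bool" where
  "closed_form2 X \<omega> \<longleftrightarrow>
     (\<forall>p\<in>X. \<exists>U \<Omega>. p \<in> U \<and> local_extension X \<omega> U \<Omega> \<and>
        (\<forall>x\<in>X \<inter> U. \<forall>u\<in>tangent_space X x. \<forall>v\<in>tangent_space X x. \<forall>w\<in>tangent_space X x.
           ext_deriv \<Omega> x u v w = 0))"

definition nondegenerate_form2 :: "'a::euclidean_space set \<Rightarrow> 'a form2 \<Rightarrow> bool" where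
  "nondegenerate_form2 X \<omega> \<longleftrightarrow>
     (\<forall>p\<in>X. \<forall>v\<in>tangent_space X p. (\<forall>w\<in>tangent_space X p. \<omega> p v w = 0) \<longrightarrow> v = 0)"

definition symplectic_form :: "'a::euclidean_space set \<Rightarrow> 'a form2 \<Rightarrow> bool" where
  "symplectic_form X \<omega> \<longleftrightarrow>
     smooth_form2 X \<omega> \<and> closed_form2 X \<omega> \<and> nondegenerate_form2 X \<omega>"

definition pullback ::
    "('a::euclidean_space \<Rightarrow> 'b::euclidean_space) \<Rightarrow> 'b form2 \<Rightarrow> 'a form2" where
  "pullback f \<omega> x v w =
     \<omega> (f x) (frechet_derivative f (at x) v) (frechet_derivative f (at x) w)"

text \<open>Comass of a 2-form \<open>\<eta>\<close> on \<open>X\<close> with respect to a Riemannian metric \<open>g\<close>.  The squared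
  area of the bivector \<open>v \<and> w\<close> is the Gram determinant of \<open>v, w\<close>.\<close>

definition comass ::
    "'a::euclidean_space set \<Rightarrow> ('a \<Rightarrow> 'a \<Rightarrow> 'a \<Rightarrow> real) \<Rightarrow> 'a form2 \<Rightarrow> ereal" where
  "comass X g \<eta> =
     Sup {ereal (\<eta> p v w) | p v w. p \<in> X \<and> v \<in> tangent_space X p \<and> w \<in> tangent_space X p \<and>
            sqrt (g p v v * g p w w - (g p v w)\<^sup>2) = 1}"


section \<open>The Gromov width\<close>

text \<open>The standard linear symplectic form, the sum of the \<open>dx\<^sub>i \<and> dy\<^sub>i\<close>, on the real vector
  space \<open>complex ^ 'm\<close> of dimension \<open>2 * CARD('m)\<close> with coordinates \<open>z\<^sub>i = x\<^sub>i + i y\<^sub>i\<close>.\<close>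

definition omega_std :: "complex ^ 'm \<Rightarrow> complex ^ 'm \<Rightarrow> real" where
  "omega_std v w = (\<Sum>i\<in>UNIV. Re (v $ i) * Im (w $ i) - Im (v $ i) * Re (w $ i))"

definition smooth_embedding ::
    "'a::euclidean_space set \<Rightarrow> 'b::euclidean_space set \<Rightarrow> ('a \<Rightarrow> 'b) \<Rightarrow> bool" where
  "smooth_embedding U X f \<longleftrightarrow>
     smooth_on U f \<and> f ` U \<subseteq> X \<and> (\<forall>x\<in>U. inj (frechet_derivative f (at x))) \<and>
     (\<exists>g. homeomorphism U (f ` U) f g)"

definition symplectic_ball_embedding ::
    "real \<Rightarrow> 'a::euclidean_space set \<Rightarrow> 'a form2 \<Rightarrow> (complex ^ 'm \<Rightarrow> 'a) \<Rightarrow> bool" where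
  "symplectic_ball_embedding R X \<omega> f \<longleftrightarrow>
     smooth_embedding (ball 0 R) X f \<and>
     (\<forall>x\<in>ball 0 R. \<forall>v w. pullback f \<omega> x v w = omega_std v w)"

text \<open>The type argument fixes the dimension \<open>2 * CARD('m)\<close> of the balls, to be instantiated so
  that it equals the dimension of \<open>X\<close>.\<close>

definition gromov_width ::
    "'m::finite itself \<Rightarrow> 'a::euclidean_space set \<Rightarrow> 'a form2 \<Rightarrow> ennreal" where
  "gromov_width _ X \<omega> =
     Sup {ennreal (pi * R\<^sup>2) | R. 0 < R \<and>
            (\<exists>f :: complex ^ 'm \<Rightarrow> 'a. symplectic_ball_embedding R X \<omega> f)}"


section \<open>The standard structures on the product of the 2-sphere and Euclidean space\<close>

abbreviation S2 :: "(real ^ 3) set" where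
  "S2 \<equiv> sphere 0 1"

text \<open>The integrable complex structure of the sphere is the rotation by a right angle in the
  tangent planes.  Stereographic projection from the south pole,
  \<open>(x, y, t) \<mapsto> (x + i y) / (1 + t)\<close>, identifies it with the one of the projective line.\<close>

definition J_S2 :: "real ^ 3 \<Rightarrow> real ^ 3 \<Rightarrow> real ^ 3" where
  "J_S2 p v = cross3 p v"

definition compatible_S2 :: "(real ^ 3) form2 \<Rightarrow> bool" where
  "compatible_S2 \<sigma> \<longleftrightarrow>
     (\<forall>p\<in>S2. \<forall>v\<in>tangent_space S2 p. \<forall>w\<in>tangent_space S2 p.
        \<sigma> p (J_S2 p v) (J_S2 p w) = \<sigma> p v w \<and> (v \<noteq> 0 \<longrightarrow> 0 < \<sigma> p v (J_S2 p v)))"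

text \<open>The integral of a 2-form over the sphere with the complex orientation, computed in
  spherical coordinates (polar angle, azimuth), which are positively oriented and
  parametrize the complement of a null set.\<close>

definition spherical :: "real \<times> real \<Rightarrow> real ^ 3" where
  "spherical = (\<lambda>(\<theta>, \<phi>). vector [sin \<theta> * cos \<phi>, sin \<theta> * sin \<phi>, cos \<theta>])"

definition total_area :: "(real ^ 3) form2 \<Rightarrow> real" where
  "total_area \<sigma> = integral (cbox (0, 0) (pi, 2 * pi)) (\<lambda>t. pullback spherical \<sigma> t (1, 0) (0, 1))"

definition unit_area_form :: "(real ^ 3) form2 \<Rightarrow> bool" where
  "unit_area_form \<sigma> \<longleftrightarrow> symplectic_form S2 \<sigma> \<and> compatible_S2 \<sigma> \<and> total_area \<sigma> = 1"

text \<open>\<open>\<real>\<^sup>2\<^sup>n\<close> is \<open>complex ^ 'n\<close> with \<open>CARD('n) = n\<close>.\<close>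

definition S2_R2n :: "((real ^ 3) \<times> (complex ^ 'n)) set" where
  "S2_R2n = S2 \<times> UNIV"

definition omega0 :: "(real ^ 3) form2 \<Rightarrow> ((real ^ 3) \<times> (complex ^ 'n)) form2" where
  "omega0 \<sigma> p v w = \<sigma> (fst p) (fst v) (fst w) + omega_std (snd v) (snd w)"

definition J0 ::
    "(real ^ 3) \<times> (complex ^ 'n) \<Rightarrow> (real ^ 3) \<times> (complex ^ 'n) \<Rightarrow> (real ^ 3) \<times> (complex ^ 'n)" where
  "J0 p v = (J_S2 (fst p) (fst v), \<i> *s snd v)"

definition g0 ::
    "(real ^ 3) form2 \<Rightarrow> (real ^ 3) \<times> (complex ^ 'n) \<Rightarrow>
     (real ^ 3) \<times> (complex ^ 'n) \<Rightarrow> (real ^ 3) \<times> (complex ^ 'n) \<Rightarrow> real" where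
  "g0 \<sigma> p v w = omega0 \<sigma> p v (J0 p w)"

end

theory Submission
  imports Defs
begin

text \<open>The idea is to replace \<omega>0, in which the sphere has area 1, by an exact symplectic form that still has
bounded coefficients. Write a point of the product as (q, y, t, \<zeta>) with q in the unit sphere of
\<real>^3, y \<in> \<real>^3, t \<in> \<real> and \<zeta> \<in> \<complex>^(n - 2); here n \<ge> 2 enters. The tangent bundle of the sphere is
stably trivial: y = p + s q with p orthogonal to q, so (q, y) is a point (q, p) of T*S^2 together with a
number s. The natural symplectic form on T*S^2 \<times> \<real>^2 \<times> \<complex>^(n - 2) would be
d(y \<cdot> dq) + ds \<and> dt + \<omega>_std, but ds = q \<cdot> dy + y \<cdot> dq grows linearly with y. The remedy is to
replace s by \<tau> = (q \<cdot> y) / sqrt (1 + y \<cdot> y), which has bounded first derivatives and, for fixed (q, p),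
is an increasing function of s with range (-1, 1). Thus \<omega> = d(y \<cdot> dq) + d\<tau> \<and> dt + \<omega>_std is
symplectic (\<open>symplectic_wide_form\<close>) and differs from \<omega>0 by a bounded form
(\<open>wide_form_bounded\<close>, \<open>comass_diff_omega0_finite\<close>).

As a symplectic manifold the result is T*S^2 \<times> (-1, 1) \<times> \<real> \<times> \<complex>^(n - 2). The cotangent bundle of an
open hemisphere, which is diffeomorphic to the plane, is a copy of \<real>^4, and the strip (-1, 1) \<times> \<real> has
infinite area, hence is symplectomorphic to the plane. So the whole of \<complex>^(n + 1) embeds symplectically
(\<open>symplectic_ball_embedding_wide_map\<close>), and with it balls of every radius.\<close>

section \<open>Calculus of smooth maps\<close>

lemma frechet_derivative_cong_open:
  assumes "open S" "x \<in> S" "\<And>y. y \<in> S \<Longrightarrow> f y = g y"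
  shows "f differentiable (at x) \<longleftrightarrow> g differentiable (at x)"
    and "f differentiable (at x) \<Longrightarrow> frechet_derivative f (at x) = frechet_derivative g (at x)"
proof -
  have *: "(f has_derivative D) (at x) \<longleftrightarrow> (g has_derivative D) (at x)" for D
    using has_derivative_transform_within_open[of f D x UNIV S g]
      has_derivative_transform_within_open[of g D x UNIV S f] assms by auto
  show "f differentiable (at x) \<longleftrightarrow> g differentiable (at x)"
    by (simp add: differentiable_def *)
  show "frechet_derivative f (at x) = frechet_derivative g (at x)"
    by (simp add: frechet_derivative_def *)
qed

lemma C_k_on_cong:
  assumes "open S" "\<And>y. y \<in> S \<Longrightarrow> f y = g y"
  shows "C_k_on k S f \<longleftrightarrow> C_k_on k S g"
  using assms(2)
proof (induction k arbitrary: f g)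
  case 0
  then show ?case using continuous_on_cong[of S S f g] by simp
next
  case (Suc k)
  have d: "f differentiable (at x) \<longleftrightarrow> g differentiable (at x)" if "x \<in> S" for x
    using frechet_derivative_cong_open(1)[OF assms(1) that] Suc.prems by blast
  show ?case
  proof (cases "\<forall>x\<in>S. f differentiable (at x)")
    case True
    have "C_k_on k S (\<lambda>x. frechet_derivative f (at x) v) \<longleftrightarrow>
          C_k_on k S (\<lambda>x. frechet_derivative g (at x) v)" for v
      by (rule Suc.IH) (use frechet_derivative_cong_open(2)[OF assms(1) _ Suc.prems] True in simp)
    with d show ?thesis by simp
  qed (use d in auto)
qed

text \<open>The recursion of \<open>C_k_on\<close> speaks of \<open>frechet_derivative\<close>; this rule lets any derivative formula
valid on the open set take its place. The closure properties below are inductions on the order by it.\<close>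

lemma C_k_on_SucI:
  assumes "open S" "\<And>x. x \<in> S \<Longrightarrow> (f has_derivative D x) (at x)"
    and "\<And>v. C_k_on k S (\<lambda>x. D x v)"
  shows "C_k_on (Suc k) S f"
proof -
  have "frechet_derivative f (at x) v = D x v" if "x \<in> S" for x v
    using frechet_derivative_at[OF assms(2)[OF that]] by simp
  then have "C_k_on k S (\<lambda>x. frechet_derivative f (at x) v)" for v
    using C_k_on_cong[OF assms(1), of "\<lambda>x. frechet_derivative f (at x) v" "\<lambda>x. D x v"] assms(3)
    by simp
  with assms(2) show ?thesis by (auto simp: differentiable_def)
qed

lemma C_k_on_SucD:
  assumes "C_k_on (Suc k) S f" "x \<in> S"
  shows "(f has_derivative frechet_derivative f (at x)) (at x)"
  using assms frechet_derivative_works by auto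

lemma C_k_on_Suc_imp: "C_k_on (Suc k) S f \<Longrightarrow> C_k_on k S f"
proof (induction k arbitrary: f)
  case 0
  then show ?case
    by (auto intro!: continuous_at_imp_continuous_on differentiable_imp_continuous_within)
next
  case (Suc k)
  have "\<forall>x\<in>S. f differentiable (at x)" "\<And>v. C_k_on (Suc k) S (\<lambda>x. frechet_derivative f (at x) v)"
    using Suc.prems by simp_all
  with Suc.IH have "\<forall>x\<in>S. f differentiable (at x)" "\<And>v. C_k_on k S (\<lambda>x. frechet_derivative f (at x) v)"
    by blast+
  then show ?case by simp
qed

lemma C_k_on_subset: "C_k_on k S f \<Longrightarrow> T \<subseteq> S \<Longrightarrow> C_k_on k T f"
  by (induction k arbitrary: f) (auto intro: continuous_on_subset)

lemma C_k_on_const: "open S \<Longrightarrow> C_k_on k S (\<lambda>x. c)"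
proof (induction k arbitrary: c)
  case (Suc k)
  show ?case by (rule C_k_on_SucI[where D = "\<lambda>_ _. 0"]) (use Suc in auto)
qed simp

lemma C_k_on_linear:
  assumes "open S" "bounded_linear L"
  shows "C_k_on k S L"
proof (cases k)
  case 0
  then show ?thesis using assms by (simp add: linear_continuous_on)
next
  case (Suc m)
  show ?thesis unfolding Suc
    by (rule C_k_on_SucI[where D = "\<lambda>_. L"])
      (use assms bounded_linear_imp_has_derivative C_k_on_const in auto)
qed

lemma C_k_on_compose_linear:
  assumes "open S" "bounded_linear L" "C_k_on k S f"
  shows "C_k_on k S (\<lambda>x. L (f x))"
  using assms(3)
proof (induction k arbitrary: f)
  case 0
  then show ?case using assms(2) by (simp add: bounded_linear.continuous_on)
next
  case (Suc k)
  show ?case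
  proof (rule C_k_on_SucI[where D = "\<lambda>x v. L (frechet_derivative f (at x) v)"])
    show "((\<lambda>x. L (f x)) has_derivative (\<lambda>v. L (frechet_derivative f (at x) v))) (at x)" if "x \<in> S" for x
      by (rule bounded_linear.has_derivative[OF assms(2) C_k_on_SucD[OF Suc.prems that]])
    show "C_k_on k S (\<lambda>x. L (frechet_derivative f (at x) v))" for v
      using Suc by simp
  qed (fact assms)
qed

lemma C_k_on_add:
  assumes "open S" "C_k_on k S f" "C_k_on k S g"
  shows "C_k_on k S (\<lambda>x. f x + g x)"
  using assms(2,3)
proof (induction k arbitrary: f g)
  case 0
  then show ?case by (simp add: continuous_on_add)
next
  case (Suc k)
  show ?case
  proof (rule C_k_on_SucI[where D = "\<lambda>x v. frechet_derivative f (at x) v + frechet_derivative g (at x) v"])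
    show "((\<lambda>x. f x + g x) has_derivative (\<lambda>v. frechet_derivative f (at x) v + frechet_derivative g (at x) v)) (at x)"
      if "x \<in> S" for x
      using C_k_on_SucD[OF Suc.prems(1) that] C_k_on_SucD[OF Suc.prems(2) that]
      by (rule has_derivative_add)
    show "C_k_on k S (\<lambda>x. frechet_derivative f (at x) v + frechet_derivative g (at x) v)" for v
      using Suc by simp
  qed (fact assms)
qed

lemma C_k_on_bilinear:
  assumes "open S" "bounded_bilinear B" "C_k_on k S f" "C_k_on k S g"
  shows "C_k_on k S (\<lambda>x. B (f x) (g x))"
  using assms(3,4)
proof (induction k arbitrary: f g)
  case 0
  then show ?case using assms(2) by (simp add: bounded_bilinear.continuous_on)
next
  case (Suc k)
  show ?case
  proof (rule C_k_on_SucI[where D = "\<lambda>x v. B (f x) (frechet_derivative g (at x) v)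
                                       + B (frechet_derivative f (at x) v) (g x)"])
    show "((\<lambda>x. B (f x) (g x)) has_derivative (\<lambda>v. B (f x) (frechet_derivative g (at x) v)
                                       + B (frechet_derivative f (at x) v) (g x))) (at x)"
      if "x \<in> S" for x
      using C_k_on_SucD[OF Suc.prems(1) that] C_k_on_SucD[OF Suc.prems(2) that]
      by (rule bounded_bilinear.FDERIV[OF assms(2)])
    show "C_k_on k S (\<lambda>x. B (f x) (frechet_derivative g (at x) v)
                        + B (frechet_derivative f (at x) v) (g x))" for v
      using Suc.prems C_k_on_Suc_imp[OF Suc.prems(1)] C_k_on_Suc_imp[OF Suc.prems(2)]
      by (intro C_k_on_add Suc.IH assms(1)) auto
  qed (fact assms)
qed

text \<open>The derivative of the reciprocal is a polynomial in the reciprocal and in the derivative of f,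
so order k of the reciprocal gives order k + 1. The same mechanism handles the square root below,
via its reciprocal.\<close>

lemma C_k_on_inverse:
  fixes f :: "'a::real_normed_vector \<Rightarrow> real"
  assumes "open S" "\<And>x. x \<in> S \<Longrightarrow> f x \<noteq> 0" "C_k_on k S f"
  shows "C_k_on k S (\<lambda>x. inverse (f x))"
  using assms(2,3)
proof (induction k)
  case 0
  then show ?case by (simp add: continuous_on_inverse)
next
  case (Suc k)
  have i: "C_k_on k S (\<lambda>x. inverse (f x))" using Suc.IH[OF Suc.prems(1) C_k_on_Suc_imp[OF Suc.prems(2)]] .
  show ?case
  proof (rule C_k_on_SucI[where D = "\<lambda>x v. - (inverse (f x) * frechet_derivative f (at x) v * inverse (f x))"])
    show "((\<lambda>x. inverse (f x)) has_derivative
            (\<lambda>v. - (inverse (f x) * frechet_derivative f (at x) v * inverse (f x)))) (at x)"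
      if "x \<in> S" for x
      using Suc.prems(1)[OF that] C_k_on_SucD[OF Suc.prems(2) that] by (rule Deriv.has_derivative_inverse)
    show "C_k_on k S (\<lambda>x. - (inverse (f x) * frechet_derivative f (at x) v * inverse (f x)))" for v
      using Suc.prems i
      by (intro C_k_on_compose_linear[OF assms(1) bounded_linear_minus[OF bounded_linear_ident]]
          C_k_on_bilinear[OF assms(1) bounded_bilinear_mult]) auto
  qed (fact assms)
qed

lemma C_k_on_sqrt:
  fixes f :: "'a::real_normed_vector \<Rightarrow> real"
  assumes "open S" "\<And>x. x \<in> S \<Longrightarrow> f x > 0" "C_k_on k S f"
  shows "C_k_on k S (\<lambda>x. sqrt (f x))"
  using assms(2,3)
proof (induction k)
  case 0
  then show ?case by (simp add: continuous_on_real_sqrt)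
next
  case (Suc k)
  have i: "C_k_on k S (\<lambda>x. inverse (sqrt (f x)))"
    using Suc.IH[OF Suc.prems(1) C_k_on_Suc_imp[OF Suc.prems(2)]] Suc.prems(1)
    by (intro C_k_on_inverse assms(1)) (force, simp)
  show ?case
  proof (rule C_k_on_SucI[where D = "\<lambda>x v. (frechet_derivative f (at x) v * (1/2)) * inverse (sqrt (f x))"])
    show "((\<lambda>x. sqrt (f x)) has_derivative
            (\<lambda>v. (frechet_derivative f (at x) v * (1/2)) * inverse (sqrt (f x)))) (at x)"
      if "x \<in> S" for x
      using has_derivative_real_sqrt[OF _ C_k_on_SucD[OF Suc.prems(2) that]] Suc.prems(1)[OF that]
      by (simp add: field_simps)
    show "C_k_on k S (\<lambda>x. (frechet_derivative f (at x) v * (1/2)) * inverse (sqrt (f x)))" for v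
      using Suc.prems i
      by (intro C_k_on_bilinear[OF assms(1) bounded_bilinear_mult] C_k_on_const assms(1)) auto
  qed (fact assms)
qed

lemma smooth_on_imp_continuous_on: "smooth_on S f \<Longrightarrow> continuous_on S f"
  using C_k_on.simps(1) unfolding smooth_on_def by blast

lemma smooth_on_subset: "smooth_on S f \<Longrightarrow> T \<subseteq> S \<Longrightarrow> smooth_on T f"
  using C_k_on_subset unfolding smooth_on_def by blast

lemma smooth_on_has_derivative:
  "smooth_on S f \<Longrightarrow> x \<in> S \<Longrightarrow> (f has_derivative frechet_derivative f (at x)) (at x)"
  unfolding smooth_on_def by (rule C_k_on_SucD[of 0]) blast+

context
  fixes S :: "'a::real_normed_vector set"
  assumes S: "open S"
begin

lemma smooth_on_const: "smooth_on S (\<lambda>x. c)"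
  by (simp add: smooth_on_def C_k_on_const S)

lemma smooth_on_linear: "bounded_linear L \<Longrightarrow> smooth_on S L"
  by (simp add: smooth_on_def C_k_on_linear S)

lemma smooth_on_compose_linear: "bounded_linear L \<Longrightarrow> smooth_on S f \<Longrightarrow> smooth_on S (\<lambda>x. L (f x))"
  by (simp add: smooth_on_def C_k_on_compose_linear S)

lemma smooth_on_add: "smooth_on S f \<Longrightarrow> smooth_on S g \<Longrightarrow> smooth_on S (\<lambda>x. f x + g x)"
  by (simp add: smooth_on_def C_k_on_add S)

lemma smooth_on_bilinear:
  "bounded_bilinear B \<Longrightarrow> smooth_on S f \<Longrightarrow> smooth_on S g \<Longrightarrow> smooth_on S (\<lambda>x. B (f x) (g x))"
  by (simp add: smooth_on_def C_k_on_bilinear S)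

lemmas smooth_on_mult = smooth_on_bilinear[OF bounded_bilinear_mult]
lemmas smooth_on_scaleR = smooth_on_bilinear[OF bounded_bilinear_scaleR]
lemmas smooth_on_inner = smooth_on_bilinear[OF bounded_bilinear_inner]

lemma smooth_on_minus: "smooth_on S f \<Longrightarrow> smooth_on S (\<lambda>x. - f x)"
  by (rule smooth_on_compose_linear[OF bounded_linear_minus[OF bounded_linear_ident]])

lemma smooth_on_diff: "smooth_on S f \<Longrightarrow> smooth_on S g \<Longrightarrow> smooth_on S (\<lambda>x. f x - g x)"
  using smooth_on_add[of f "\<lambda>x. - g x"] smooth_on_minus[of g] by simp

lemma smooth_on_inverse:
  "(\<And>x. x \<in> S \<Longrightarrow> f x \<noteq> (0::real)) \<Longrightarrow> smooth_on S f \<Longrightarrow> smooth_on S (\<lambda>x. inverse (f x))"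
  by (simp add: smooth_on_def C_k_on_inverse S)

lemma smooth_on_sqrt:
  "(\<And>x. x \<in> S \<Longrightarrow> f x > (0::real)) \<Longrightarrow> smooth_on S f \<Longrightarrow> smooth_on S (\<lambda>x. sqrt (f x))"
  by (simp add: smooth_on_def C_k_on_sqrt S)

lemma smooth_on_power: "smooth_on S f \<Longrightarrow> smooth_on S (\<lambda>x. f x ^ n :: real)"
  by (induction n) (simp_all add: smooth_on_const smooth_on_mult)

lemma smooth_on_sum: "(\<And>i. i \<in> I \<Longrightarrow> smooth_on S (f i)) \<Longrightarrow> smooth_on S (\<lambda>x. \<Sum>i\<in>I. f i x)"
  by (induction I rule: infinite_finite_induct) (simp_all add: smooth_on_const smooth_on_add)

lemma smooth_on_euclidean:
  fixes f :: "'a \<Rightarrow> 'b::euclidean_space"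
  assumes "\<And>b. b \<in> Basis \<Longrightarrow> smooth_on S (\<lambda>x. f x \<bullet> b)"
  shows "smooth_on S f"
proof -
  have "smooth_on S (\<lambda>x. \<Sum>b\<in>Basis. (f x \<bullet> b) *\<^sub>R b)"
    by (rule smooth_on_sum, rule smooth_on_scaleR[OF assms smooth_on_const])
  then show ?thesis by (simp add: euclidean_representation)
qed

lemma smooth_on_vec:
  fixes f :: "'a \<Rightarrow> 'b::euclidean_space ^ 'n"
  assumes "\<And>i. smooth_on S (\<lambda>x. f x $ i)"
  shows "smooth_on S f"
proof (rule smooth_on_euclidean)
  fix b :: "'b ^ 'n" assume "b \<in> Basis"
  then obtain i u where "b = axis i u" by (auto simp: Basis_vec_def)
  then have "(\<lambda>x. f x \<bullet> b) = (\<lambda>x. f x $ i \<bullet> u)" by (simp add: inner_axis)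
  then show "smooth_on S (\<lambda>x. f x \<bullet> b)"
    by (simp add: smooth_on_inner[OF assms smooth_on_const])
qed

lemma smooth_on_Pair:
  fixes f :: "'a \<Rightarrow> 'b::euclidean_space" and g :: "'a \<Rightarrow> 'c::euclidean_space"
  assumes "smooth_on S f" "smooth_on S g"
  shows "smooth_on S (\<lambda>x. (f x, g x))"
proof (rule smooth_on_euclidean)
  fix b :: "'b \<times> 'c"
  show "smooth_on S (\<lambda>x. (f x, g x) \<bullet> b)"
    using smooth_on_add[OF smooth_on_inner[OF assms(1) smooth_on_const[of "fst b"]]
        smooth_on_inner[OF assms(2) smooth_on_const[of "snd b"]]]
    by (simp add: inner_prod_def)
qed

lemma smooth_on_Complex:
  assumes "smooth_on S f" "smooth_on S g"
  shows "smooth_on S (\<lambda>x. Complex (f x) (g x))"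
proof (rule smooth_on_euclidean)
  fix b :: complex
  show "smooth_on S (\<lambda>x. Complex (f x) (g x) \<bullet> b)"
    using smooth_on_add[OF smooth_on_mult[OF assms(1) smooth_on_const[of "Re b"]]
        smooth_on_mult[OF assms(2) smooth_on_const[of "Im b"]]]
    by (simp add: inner_complex_def)
qed

end

section \<open>Tangent spaces and area forms on the sphere\<close>

text \<open>One inclusion differentiates \<gamma> \<bullet> \<gamma> = 1; for the other, the straight line p + t v is projected
radially to the sphere, where the normalizing factor is stationary at t = 0.\<close>

lemma tangent_space_sphere:
  fixes p :: "'a::euclidean_space"
  assumes p: "p \<in> sphere 0 1"
  shows "tangent_space (sphere 0 1) p = {v. p \<bullet> v = 0}"
proof (intro equalityI subsetI)
  fix v assume "v \<in> tangent_space (sphere 0 1) p"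
  then obtain \<gamma> and e :: real where e: "0 < e" and im: "\<gamma> ` {-e<..<e} \<subseteq> sphere 0 1"
    and p0: "\<gamma> 0 = p" and d: "(\<gamma> has_vector_derivative v) (at 0)"
    unfolding tangent_space_def by blast
  have "((\<lambda>t. \<gamma> t \<bullet> \<gamma> t) has_derivative (\<lambda>h. \<gamma> 0 \<bullet> (h *\<^sub>R v) + (h *\<^sub>R v) \<bullet> \<gamma> 0)) (at 0)"
    using d unfolding has_vector_derivative_def by (intro has_derivative_inner)
  moreover have "((\<lambda>t. \<gamma> t \<bullet> \<gamma> t) has_derivative (\<lambda>h. 0)) (at 0)"
  proof (rule has_derivative_transform_within_open[OF has_derivative_const, of "{-e<..<e}" 0 1])
    show "1 = \<gamma> t \<bullet> \<gamma> t" if "t \<in> {-e<..<e}" for t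
      using im that by (auto simp: image_subset_iff dot_square_norm)
  qed (use e in auto)
  ultimately have "(\<lambda>h. \<gamma> 0 \<bullet> (h *\<^sub>R v) + (h *\<^sub>R v) \<bullet> \<gamma> 0) = (\<lambda>h. 0)"
    by (rule has_derivative_unique)
  from fun_cong[OF this, of 1] show "v \<in> {v. p \<bullet> v = 0}"
    using p0 by (simp add: inner_commute)
next
  fix v assume "v \<in> {v. p \<bullet> v = 0}"
  then have v: "p \<bullet> v = 0" by simp
  define n where "n t = 1 + t\<^sup>2 * (v \<bullet> v)" for t :: real
  define \<gamma> where "\<gamma> t = inverse (sqrt (n t)) *\<^sub>R (p + t *\<^sub>R v)" for t
  have n: "n t > 0" for t by (simp add: n_def add_pos_nonneg)
  have s: "smooth_on {-1<..<1} \<gamma>"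
    unfolding \<gamma>_def n_def using n[unfolded n_def]
    by (intro smooth_on_scaleR smooth_on_inverse smooth_on_sqrt smooth_on_add smooth_on_const
        smooth_on_mult smooth_on_power smooth_on_linear bounded_linear_ident open_greaterThanLessThan)
       (auto simp: less_imp_neq[symmetric])
  have "norm (\<gamma> t) = 1" for t
  proof -
    have "(p + t *\<^sub>R v) \<bullet> (p + t *\<^sub>R v) = n t"
      using p v norm_eq_1[of p]
      by (simp add: n_def inner_add_left inner_add_right inner_commute[of v p] power2_eq_square)
    then have "norm (p + t *\<^sub>R v) = sqrt (n t)" by (simp add: norm_eq_sqrt_inner)
    then show ?thesis using n[of t] by (simp add: \<gamma>_def)
  qed
  moreover have "(\<gamma> has_vector_derivative v) (at 0)"
  proof -
    have "((\<lambda>t. inverse (sqrt (n t))) has_real_derivative 0) (at 0)"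
      unfolding n_def by (auto intro!: derivative_eq_intros)
    moreover have "((\<lambda>t. p + t *\<^sub>R v) has_vector_derivative v) (at 0)"
      by (auto intro!: derivative_eq_intros)
    ultimately have "((\<lambda>t. inverse (sqrt (n t)) *\<^sub>R (p + t *\<^sub>R v)) has_vector_derivative
        inverse (sqrt (n 0)) *\<^sub>R v + 0 *\<^sub>R (p + 0 *\<^sub>R v)) (at 0)"
      by (rule has_vector_derivative_scaleR)
    then show ?thesis by (simp add: \<gamma>_def[abs_def] n_def)
  qed
  moreover have "\<gamma> 0 = p" by (simp add: \<gamma>_def n_def)
  ultimately show "v \<in> tangent_space (sphere 0 1) p"
    unfolding tangent_space_def using s
    by (intro CollectI exI[of _ \<gamma>] exI[of _ "1::real"]) auto
qed

lemma tangent_space_times_UNIV: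
  fixes X :: "'a::euclidean_space set" and z :: "'b::euclidean_space"
  shows "tangent_space (X \<times> UNIV) (p, z) = tangent_space X p \<times> UNIV"
proof (intro equalityI subsetI)
  fix V assume "V \<in> tangent_space (X \<times> UNIV) (p, z)"
  then obtain \<gamma> and e :: real where e: "0 < e" "smooth_on {-e<..<e} \<gamma>" "\<gamma> ` {-e<..<e} \<subseteq> X \<times> UNIV"
    "\<gamma> 0 = (p, z)" "(\<gamma> has_vector_derivative V) (at 0)"
    unfolding tangent_space_def by blast
  have "((\<lambda>t. fst (\<gamma> t)) has_vector_derivative fst V) (at 0)"
    by (rule bounded_linear.has_vector_derivative[OF bounded_linear_fst e(5)])
  moreover have "smooth_on {-e<..<e} (\<lambda>t. fst (\<gamma> t))"
    by (rule smooth_on_compose_linear[OF _ bounded_linear_fst e(2)]) simp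
  ultimately have "fst V \<in> tangent_space X p"
    unfolding tangent_space_def using e
    by (intro CollectI exI[of _ "\<lambda>t. fst (\<gamma> t)"] exI[of _ e]) (force simp: image_subset_iff)
  then show "V \<in> tangent_space X p \<times> UNIV" by (auto simp: mem_Times_iff)
next
  fix V assume "V \<in> tangent_space X p \<times> (UNIV :: 'b set)"
  then obtain v w where V: "V = (v, w)" and "v \<in> tangent_space X p" by auto
  then obtain \<gamma> and e :: real where e: "0 < e" "smooth_on {-e<..<e} \<gamma>" "\<gamma> ` {-e<..<e} \<subseteq> X"
    "\<gamma> 0 = p" "(\<gamma> has_vector_derivative v) (at 0)"
    unfolding tangent_space_def by blast
  have "smooth_on {-e<..<e} (\<lambda>t. z + t *\<^sub>R w)"
    by (intro smooth_on_add smooth_on_const smooth_on_linear bounded_linear_scaleR_left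
        open_greaterThanLessThan)
  then have "smooth_on {-e<..<e} (\<lambda>t. (\<gamma> t, z + t *\<^sub>R w))"
    by (intro smooth_on_Pair e(2) open_greaterThanLessThan)
  moreover have "((\<lambda>t. (\<gamma> t, z + t *\<^sub>R w)) has_vector_derivative V) (at 0)"
    unfolding V by (intro has_vector_derivative_Pair e(5)) (auto intro!: derivative_eq_intros)
  ultimately show "V \<in> tangent_space (X \<times> UNIV) (p, z)"
    unfolding tangent_space_def using e
    by (intro CollectI exI[of _ "\<lambda>t. (\<gamma> t, z + t *\<^sub>R w)"] exI[of _ e]) auto
qed

lemma bilinear_eq_sum_Basis:
  fixes h :: "'a::euclidean_space \<Rightarrow> 'a \<Rightarrow> real"
  assumes "bilinear h"
  shows "h a b = (\<Sum>k\<in>Basis. \<Sum>l\<in>Basis. (a \<bullet> k) * (b \<bullet> l) * h k l)"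
proof -
  have "h a b = h (\<Sum>k\<in>Basis. (a \<bullet> k) *\<^sub>R k) (\<Sum>l\<in>Basis. (b \<bullet> l) *\<^sub>R l)"
    by (simp add: euclidean_representation)
  also have "\<dots> = (\<Sum>(k, l)\<in>Basis \<times> Basis. h ((a \<bullet> k) *\<^sub>R k) ((b \<bullet> l) *\<^sub>R l))"
    by (rule bilinear_sum[OF assms])
  finally show ?thesis
    by (simp add: sum.cartesian_product bilinear_lmul[OF assms] bilinear_rmul[OF assms] mult_ac)
qed

text \<open>A tangent plane of the sphere is two-dimensional, so any alternating form on it is a multiple of
the Euclidean area \<open>q \<bullet> cross3 v w\<close>. Continuity of the factor is what makes it bounded, above and away
from zero, on the compact sphere; it is read off from an explicit formula for the factor that involves
no choice of a frame, which the sphere would not allow continuously.\<close>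

lemma form2_on_S2_eq_area:
  assumes sm: "smooth_form2 S2 \<sigma>"
  obtains \<mu> where "continuous_on S2 \<mu>"
    and "\<And>q v w. q \<in> S2 \<Longrightarrow> q \<bullet> v = 0 \<Longrightarrow> q \<bullet> w = 0 \<Longrightarrow> \<sigma> q v w = \<mu> q * (q \<bullet> cross3 v w)"
proof -
  \<comment> \<open>The vectors \<open>cross3 q k\<close> have squared lengths adding up to 2, whence the division.\<close>
  define \<mu> where "\<mu> q = (\<Sum>k\<in>Basis. \<sigma> q (cross3 q k) (cross3 q (cross3 q k))) / 2" for q
  have tang: "v \<in> tangent_space S2 q \<longleftrightarrow> q \<bullet> v = 0" if "q \<in> S2" for q v
    using tangent_space_sphere[OF that] by auto
  have "continuous_on S2 \<mu>"
    unfolding continuous_on_eq_continuous_within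
  proof
    fix p assume p: "p \<in> S2"
    then obtain U \<Omega> where pU: "p \<in> U" and U: "open U" and \<Omega>: "smooth_form2_on U \<Omega>"
      and eq: "\<And>x v w. x \<in> S2 \<inter> U \<Longrightarrow> v \<in> tangent_space S2 x \<Longrightarrow> w \<in> tangent_space S2 x \<Longrightarrow> \<Omega> x v w = \<sigma> x v w"
      using sm unfolding smooth_form2_def local_extension_def by metis
    have c: "continuous_on U (\<lambda>x. \<Omega> x v w)" for v w
      using \<Omega> smooth_on_imp_continuous_on unfolding smooth_form2_on_def by blast
    define \<nu> where "\<nu> q = (\<Sum>k\<in>Basis. \<Sum>a\<in>Basis. \<Sum>b\<in>Basis.
        (cross3 q k \<bullet> a) * (cross3 q (cross3 q k) \<bullet> b) * \<Omega> q a b) / 2" for q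
    have "continuous_on U \<nu>"
      unfolding \<nu>_def by (intro continuous_intros continuous_on_cross c) simp
    then have "continuous_on (S2 \<inter> U) \<nu>" by (rule continuous_on_subset) simp
    moreover have "\<nu> q = \<mu> q" if "q \<in> S2" "q \<in> U" for q
    proof -
      have "bilinear (\<Omega> q)" using \<Omega> that unfolding smooth_form2_on_def by blast
      then have "\<nu> q = (\<Sum>k\<in>Basis. \<Omega> q (cross3 q k) (cross3 q (cross3 q k))) / 2"
        by (simp only: \<nu>_def bilinear_eq_sum_Basis[symmetric])
      also have "\<dots> = \<mu> q"
        unfolding \<mu>_def using that
        by (intro arg_cong[where f = "\<lambda>s. s / 2"] sum.cong refl eq) (auto simp: tang dot_cross_self)
      finally show ?thesis .
    qed
    ultimately have "continuous_on (S2 \<inter> U) \<mu>"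
      using continuous_on_cong[of "S2 \<inter> U" "S2 \<inter> U" \<nu> \<mu>] by simp
    then have "continuous (at p within S2 \<inter> U) \<mu>"
      using p pU by (simp add: continuous_on_eq_continuous_within)
    also have "at p within S2 \<inter> U = at p within S2"
      using pU U by (intro at_within_nhd) auto
    finally show "continuous (at p within S2) \<mu>" .
  qed
  moreover have "\<sigma> q v w = \<mu> q * (q \<bullet> cross3 v w)"
    if q: "q \<in> S2" and v: "q \<bullet> v = 0" and w: "q \<bullet> w = 0" for q v w
  proof -
    obtain U \<Omega> where "q \<in> U" and \<Omega>: "smooth_form2_on U \<Omega>"
      and eq: "\<And>x v w. x \<in> S2 \<inter> U \<Longrightarrow> v \<in> tangent_space S2 x \<Longrightarrow> w \<in> tangent_space S2 x \<Longrightarrow> \<Omega> x v w = \<sigma> x v w"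
      using sm q unfolding smooth_form2_def local_extension_def by metis
    define h where "h = \<Omega> q"
    have h: "bilinear h" and alt: "h v v = 0" for v
      using \<Omega> \<open>q \<in> U\<close> unfolding smooth_form2_on_def h_def by auto
    have \<sigma>: "\<sigma> q v w = h v w" if "q \<bullet> v = 0" "q \<bullet> w = 0" for v w
      using eq[of q v w] q \<open>q \<in> U\<close> that by (simp add: h_def tang)
    have qq: "q \<bullet> q = 1" using q by (simp add: dot_square_norm)
    obtain u0 where u0: "u0 \<noteq> 0" "orthogonal q u0"
      using orthogonal_to_vector_exists[of q] by auto
    define u where "u = u0 /\<^sub>R norm u0"
    have u: "q \<bullet> u = 0" "u \<bullet> u = 1"
      using u0 by (simp_all add: u_def orthogonal_def dot_square_norm power2_eq_square)
    define n where "n = cross3 q u"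
    have nn: "n \<bullet> n = 1"
      using norm_cross_dot[of q u] u q by (simp add: n_def dot_square_norm norm_eq_1 power_mult_distrib)
    have un: "cross3 u n = q"
      unfolding n_def Lagrange using u by (simp add: inner_commute)
    define c where "c = h u n"
    have skew: "h a b = - h b a" for a b
    proof -
      have "h (a + b) (a + b) = h a a + h a b + (h b a + h b b)"
        by (simp only: bilinear_ladd[OF h] bilinear_radd[OF h])
      then show ?thesis by (simp add: alt)
    qed
    have expand: "v = (v \<bullet> u) *\<^sub>R u + (v \<bullet> n) *\<^sub>R n" if "q \<bullet> v = 0" for v
    proof -
      have "cross3 v n = (v \<bullet> u) *\<^sub>R q"
        unfolding n_def Lagrange using that by (simp add: inner_commute)
      moreover have "cross3 n q = u"
        using Lagrange[of q q u] cross_skew[of n q] u qq by (simp add: n_def)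
      ultimately have "cross3 n (cross3 v n) = (v \<bullet> u) *\<^sub>R u"
        by (simp add: cross_mult_right)
      then show ?thesis
        using Lagrange[of n v n] nn by (simp add: inner_commute algebra_simps)
    qed
    have area: "h v w = c * (q \<bullet> cross3 v w)" if v: "q \<bullet> v = 0" and w: "q \<bullet> w = 0" for v w
    proof -
      have "h v w = h ((v \<bullet> u) *\<^sub>R u + (v \<bullet> n) *\<^sub>R n) ((w \<bullet> u) *\<^sub>R u + (w \<bullet> n) *\<^sub>R n)"
        using expand[OF v] expand[OF w] by simp
      also have "\<dots> = c * ((v \<bullet> u) * (w \<bullet> n) - (v \<bullet> n) * (w \<bullet> u))"
        using skew[of n u]
        by (simp add: bilinear_ladd[OF h] bilinear_radd[OF h] bilinear_lmul[OF h] bilinear_rmul[OF h]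
            alt c_def algebra_simps)
      also have "(v \<bullet> u) * (w \<bullet> n) - (v \<bullet> n) * (w \<bullet> u) = cross3 u n \<bullet> cross3 v w"
        by (simp add: dot_cross inner_commute algebra_simps)
      finally show ?thesis by (simp add: un)
    qed
    have "h (cross3 q k) (cross3 q (cross3 q k)) = c * (norm (cross3 q k))\<^sup>2" for k
    proof -
      define x where "x = cross3 q k"
      have x: "q \<bullet> x = 0" by (simp add: x_def dot_cross_self)
      have "cross3 x (cross3 q x) = (x \<bullet> x) *\<^sub>R q"
        unfolding Lagrange using x by (simp add: inner_commute)
      then show ?thesis
        using area[OF x, of "cross3 q x"] qq by (simp add: dot_cross_self power2_norm_eq_inner flip: x_def)
    qed
    then have "\<mu> q = c * (\<Sum>k\<in>Basis. (norm (cross3 q k))\<^sup>2) / 2"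
      unfolding \<mu>_def by (simp add: \<sigma> dot_cross_self sum_distrib_left)
    also have "(\<Sum>k\<in>Basis. (norm (cross3 q k))\<^sup>2) = (\<Sum>k\<in>Basis. 1 - (q \<bullet> k)\<^sup>2)"
      using norm_cross_dot[of q] q by (intro sum.cong refl) (simp add: eq_diff_eq)
    also have "\<dots> = 2"
      using qq euclidean_inner[of q q] by (simp add: sum_subtractf power2_eq_square)
    finally have "\<mu> q = c" by simp
    then show ?thesis using area[OF v w] \<sigma>[OF v w] by simp
  qed
  ultimately show thesis by (rule that)
qed

section \<open>An exact symplectic form with bounded coefficients\<close>

lemma has_derivative_inverse_sqrt:
  assumes "(f has_derivative f') (at x)" "f x > 0"
  shows "((\<lambda>x. inverse (sqrt (f x))) has_derivative (\<lambda>h. - (f' h / 2) * inverse (sqrt (f x)) ^ 3)) (at x)"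
proof -
  have s: "sqrt (f x) > 0" using assms by simp
  have "((\<lambda>x. sqrt (f x)) has_derivative (\<lambda>h. f' h * (inverse (sqrt (f x)) / 2))) (at x)"
    using has_derivative_real_sqrt[OF assms(2,1)] s by (simp add: field_simps)
  from Deriv.has_derivative_inverse[OF _ this] s show ?thesis
    by (simp add: power3_eq_cube mult_ac)
qed

context
  fixes i j :: "'n::finite"
begin

text \<open>The components y and t of a point are spread over the complex coordinates i and j: y occupies
all of coordinate i and the real part of coordinate j, and t is the imaginary part of coordinate j.\<close>

definition yvec :: "complex ^ 'n \<Rightarrow> real ^ 3" where
  "yvec z = vector [Re (z $ i), Im (z $ i), Re (z $ j)]"

definition inv_radius :: "(real ^ 3) \<times> (complex ^ 'n) \<Rightarrow> real" where
  "inv_radius p = inverse (sqrt (1 + yvec (snd p) \<bullet> yvec (snd p)))"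

definition height :: "(real ^ 3) \<times> (complex ^ 'n) \<Rightarrow> real" where
  "height p = fst p \<bullet> yvec (snd p) * inv_radius p"

definition dheight :: "(real ^ 3) \<times> (complex ^ 'n) \<Rightarrow> (real ^ 3) \<times> (complex ^ 'n) \<Rightarrow> real" where
  "dheight p v = (fst p \<bullet> yvec (snd v) + fst v \<bullet> yvec (snd p)) * inv_radius p
     - (fst p \<bullet> yvec (snd p)) * (yvec (snd p) \<bullet> yvec (snd v)) * inv_radius p ^ 3"

text \<open>The summands are the sum of the dy_k \<and> dq_k, which is d(y \<cdot> dq), then d\<tau> \<and> dt for the function
\<tau> = \<open>height\<close>, and the standard form in the remaining coordinates.\<close>

definition wide_form :: "((real ^ 3) \<times> (complex ^ 'n)) form2" where
  "wide_form p v w = (yvec (snd v) \<bullet> fst w - yvec (snd w) \<bullet> fst v)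
     + (dheight p v * Im (snd w $ j) - dheight p w * Im (snd v $ j))
     + (\<Sum>k\<in>- {i, j}. Re (snd v $ k) * Im (snd w $ k) - Im (snd v $ k) * Re (snd w $ k))"

lemma yvec_add: "yvec (v + w) = yvec v + yvec w"
  and yvec_scaleR: "yvec (c *\<^sub>R v) = c *\<^sub>R yvec v"
  and yvec_0: "yvec 0 = 0"
  by (simp_all add: yvec_def vec_eq_iff forall_3)

lemma bounded_linear_yvec: "bounded_linear yvec"
  by (simp add: yvec_add yvec_scaleR linearI flip: linear_conv_bounded_linear)

lemma bounded_linear_yvec_snd: "bounded_linear (\<lambda>p. yvec (snd p))"
  by (rule bounded_linear_compose[OF bounded_linear_yvec bounded_linear_snd])

lemma inv_radius_pos: "inv_radius p > 0"
  by (simp add: inv_radius_def add_pos_nonneg)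

lemma inv_radius_sq: "inv_radius p ^ 2 * (1 + yvec (snd p) \<bullet> yvec (snd p)) = 1"
proof -
  have "1 + yvec (snd p) \<bullet> yvec (snd p) > 0" by (simp add: add_pos_nonneg)
  then show ?thesis by (simp add: inv_radius_def power_inverse)
qed

lemma inv_radius_has_derivative:
  "(inv_radius has_derivative (\<lambda>v. - (yvec (snd p) \<bullet> yvec (snd v)) * inv_radius p ^ 3)) (at p)"
proof -
  note Y = bounded_linear_imp_has_derivative[OF bounded_linear_yvec_snd]
  have "((\<lambda>p. 1 + yvec (snd p) \<bullet> yvec (snd p)) has_derivative
          (\<lambda>v. 0 + (yvec (snd p) \<bullet> yvec (snd v) + yvec (snd v) \<bullet> yvec (snd p)))) (at p)"
    by (intro has_derivative_add has_derivative_const has_derivative_inner Y)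
  from has_derivative_inverse_sqrt[OF this] show ?thesis
    by (simp add: inv_radius_def[abs_def] add_pos_nonneg inner_commute)
qed

lemma height_has_derivative: "(height has_derivative dheight p) (at p)"
proof -
  note Y = bounded_linear_imp_has_derivative[OF bounded_linear_yvec_snd]
  have "((\<lambda>p. fst p \<bullet> yvec (snd p) * inv_radius p) has_derivative
      (\<lambda>v. fst p \<bullet> yvec (snd p) * (- (yvec (snd p) \<bullet> yvec (snd v)) * inv_radius p ^ 3)
         + (fst p \<bullet> yvec (snd v) + fst v \<bullet> yvec (snd p)) * inv_radius p)) (at p)"
    by (intro has_derivative_mult has_derivative_inner Y inv_radius_has_derivative
        bounded_linear_imp_has_derivative bounded_linear_fst)
  then show ?thesis
    by (simp add: height_def[abs_def] dheight_def[abs_def] algebra_simps)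
qed

text \<open>Symmetry of the second derivative of \<tau>, which is exactly what closedness of d\<tau> \<and> dt requires.\<close>

lemma dheight_has_derivative:
  "\<exists>D. (\<forall>u v. D u v = D v u) \<and> (\<forall>v. ((\<lambda>p. dheight p v) has_derivative (\<lambda>u. D u v)) (at p))"
proof -
  define q y where "q = fst p" and "y = yvec (snd p)"
  define A where "A v = q \<bullet> yvec (snd v) + fst v \<bullet> y" for v :: "(real ^ 3) \<times> (complex ^ 'n)"
  define B where "B v = y \<bullet> yvec (snd v)" for v :: "(real ^ 3) \<times> (complex ^ 'n)"
  define D where "D u v = (fst u \<bullet> yvec (snd v) + fst v \<bullet> yvec (snd u)) * inv_radius p
     - (A v * B u + A u * B v + q \<bullet> y * (yvec (snd u) \<bullet> yvec (snd v))) * inv_radius p ^ 3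
     + 3 * (q \<bullet> y) * B u * B v * inv_radius p ^ 5" for u v :: "(real ^ 3) \<times> (complex ^ 'n)"
  note Y = bounded_linear_imp_has_derivative[OF bounded_linear_yvec_snd]
  have "((\<lambda>p. dheight p v) has_derivative (\<lambda>u. D u v)) (at p)" for v
  proof -
    have ds: "((\<lambda>p. fst p \<bullet> yvec (snd p)) has_derivative (\<lambda>u. q \<bullet> yvec (snd u) + fst u \<bullet> y)) (at p)"
      unfolding q_def y_def
      by (rule has_derivative_inner[OF bounded_linear_imp_has_derivative[OF bounded_linear_fst] Y])
    have dA: "((\<lambda>p. fst p \<bullet> yvec (snd v) + fst v \<bullet> yvec (snd p)) has_derivative
        (\<lambda>u. fst u \<bullet> yvec (snd v) + fst v \<bullet> yvec (snd u))) (at p)"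
      by (rule has_derivative_add[OF
          has_derivative_inner_left[OF bounded_linear_imp_has_derivative[OF bounded_linear_fst]]
          has_derivative_inner_right[OF Y]])
    have dB: "((\<lambda>p. yvec (snd p) \<bullet> yvec (snd v)) has_derivative
        (\<lambda>u. yvec (snd u) \<bullet> yvec (snd v))) (at p)"
      by (rule has_derivative_inner_left[OF Y])
    have r3: "((\<lambda>p. inv_radius p ^ 3) has_derivative (\<lambda>u. - 3 * B u * inv_radius p ^ 5)) (at p)"
      using has_derivative_power[OF inv_radius_has_derivative, of 3]
      by (simp add: B_def y_def mult_ac flip: power_add)
    show ?thesis
      unfolding dheight_def
      using has_derivative_diff[OF has_derivative_mult[OF dA inv_radius_has_derivative]
          has_derivative_mult[OF has_derivative_mult[OF ds dB] r3]]
      by (rule has_derivative_eq_rhs)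
         (simp add: fun_eq_iff D_def A_def B_def q_def y_def algebra_simps)
  qed
  moreover have "D u v = D v u" for u v
    by (simp add: D_def inner_commute algebra_simps)
  ultimately show ?thesis by blast
qed

lemma bilinear_wide_form: "bilinear (wide_form p)"
  unfolding bilinear_def wide_form_def dheight_def
  by (intro conjI allI linearI)
     (simp_all add: yvec_add yvec_scaleR inner_add_left inner_add_right algebra_simps
       sum.distrib sum_subtractf sum_distrib_left)

lemma smooth_form2_on_wide_form: "smooth_form2_on UNIV wide_form"
proof -
  have sy: "smooth_on UNIV (\<lambda>p :: (real ^ 3) \<times> (complex ^ 'n). yvec (snd p))"
    by (rule smooth_on_linear[OF open_UNIV bounded_linear_yvec_snd])
  have sf: "smooth_on UNIV (\<lambda>p :: (real ^ 3) \<times> (complex ^ 'n). fst p)"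
    by (rule smooth_on_linear[OF open_UNIV bounded_linear_fst])
  have si: "smooth_on UNIV inv_radius"
    unfolding inv_radius_def
    by (intro smooth_on_inverse smooth_on_sqrt smooth_on_add smooth_on_inner smooth_on_const sy open_UNIV)
       (auto simp: add_pos_nonneg less_imp_neq[symmetric])
  have "smooth_on UNIV (\<lambda>p. wide_form p v w)" for v w
    unfolding wide_form_def dheight_def
    by (intro smooth_on_add smooth_on_diff smooth_on_mult smooth_on_inner smooth_on_power
        smooth_on_const sy sf si open_UNIV)
  moreover have "wide_form p v v = 0" for p v
    by (simp add: wide_form_def)
  ultimately show ?thesis
    using bilinear_wide_form by (simp add: smooth_form2_on_def)
qed

lemma ext_deriv_wide_form: "ext_deriv wide_form p u v w = 0"
proof -
  obtain D where sym: "\<And>u v. D u v = D v u"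
    and D: "\<And>v. ((\<lambda>p. dheight p v) has_derivative (\<lambda>u. D u v)) (at p)"
    using dheight_has_derivative by metis
  have "frechet_derivative (\<lambda>p. wide_form p v w) (at p) = 
      (\<lambda>u. D u v * Im (snd w $ j) - D u w * Im (snd v $ j))" for v w
  proof (rule frechet_derivative_at[symmetric])
    have "((\<lambda>p. wide_form p v w) has_derivative
       (\<lambda>u. 0 + (D u v * Im (snd w $ j) - D u w * Im (snd v $ j)) + 0)) (at p)"
      unfolding wide_form_def
      by (intro has_derivative_add has_derivative_diff has_derivative_const has_derivative_mult_left D)
    then show "((\<lambda>p. wide_form p v w) has_derivative
       (\<lambda>u. D u v * Im (snd w $ j) - D u w * Im (snd v $ j))) (at p)" by simp
  qed
  then show ?thesis
    using sym[of u v] sym[of u w] sym[of v w] by (simp add: ext_deriv_def)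
qed

text \<open>The only coefficients that vary are those of d\<tau>. They stay bounded because each factor y in
\<open>dheight\<close> is compensated by a factor 1 / sqrt (1 + y \<cdot> y).\<close>

lemma wide_form_bounded:
  "\<exists>C\<ge>0. \<forall>p\<in>S2_R2n. \<forall>v w. \<bar>wide_form p v w\<bar> \<le> C * norm v * norm w"
proof -
  define h :: "(real ^ 3) \<times> (complex ^ 'n) \<Rightarrow> (real ^ 3) \<times> (complex ^ 'n) \<Rightarrow> real" where
    "h v w = (yvec (snd v) \<bullet> fst w - yvec (snd w) \<bullet> fst v)
     + (\<Sum>k\<in>- {i, j}. Re (snd v $ k) * Im (snd w $ k) - Im (snd v $ k) * Re (snd w $ k))" for v w
  have "bilinear h"
    unfolding bilinear_def h_def
    by (intro conjI allI linearI)
       (simp_all add: yvec_add yvec_scaleR inner_add_left inner_add_right algebra_simps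
         sum.distrib sum_subtractf sum_distrib_left)
  then obtain B where "\<And>v w. norm (h v w) \<le> B * norm v * norm w"
    using bilinear_bounded by blast
  then have B: "\<bar>h v w\<bar> \<le> \<bar>B\<bar> * norm v * norm w" for v w
    by (smt (verit) mult_right_mono norm_ge_zero real_norm_def)
  obtain K where K: "K > 0" "\<And>v. norm (yvec v) \<le> norm v * K"
    using bounded_linear.pos_bounded[OF bounded_linear_yvec] by blast
  \<comment> \<open>d\<tau> is at most 2 on unit vectors dy and at most 1 on unit vectors dq.\<close>
  define M where "M = 2 * K + 1"
  have dh: "\<bar>dheight p v\<bar> \<le> M * norm v" if "p \<in> S2_R2n" for p v
  proof -
    define q y r a b where "q = fst p" and "y = yvec (snd p)" and "r = inv_radius p"
      and "a = yvec (snd v)" and "b = fst v"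
    have q: "norm q = 1" using that by (auto simp: q_def S2_R2n_def)
    have r: "r > 0" "r\<^sup>2 * (1 + (norm y)\<^sup>2) = 1"
      using inv_radius_pos inv_radius_sq[of p] by (simp_all add: r_def y_def power2_norm_eq_inner)
    have rsq: "(r * norm y)\<^sup>2 + r\<^sup>2 = 1"
      using r(2) unfolding power_mult_distrib distrib_left by linarith
    then have sq: "(r * norm y)\<^sup>2 \<le> 1\<^sup>2" "r\<^sup>2 \<le> 1\<^sup>2"
      using zero_le_power2[of r] zero_le_power2[of "r * norm y"] unfolding power_one by linarith+
    have ry: "r * norm y \<le> 1" by (rule power2_le_imp_le[OF sq(1)]) simp
    have r1: "r \<le> 1" by (rule power2_le_imp_le[OF sq(2)]) simp
    have n1: "\<bar>q \<bullet> a\<bar> \<le> norm a" "\<bar>b \<bullet> y\<bar> \<le> norm b * norm y" "\<bar>q \<bullet> y\<bar> \<le> norm y" "\<bar>y \<bullet> a\<bar> \<le> norm y * norm a"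
      using Cauchy_Schwarz_ineq2[of q] Cauchy_Schwarz_ineq2[of b y] Cauchy_Schwarz_ineq2[of y a] q by auto
    have "\<bar>dheight p v\<bar> \<le> \<bar>q \<bullet> a\<bar> * r + \<bar>b \<bullet> y\<bar> * r + (\<bar>q \<bullet> y\<bar> * r) * (\<bar>y \<bullet> a\<bar> * r) * r"
    proof -
      have "dheight p v = q \<bullet> a * r + b \<bullet> y * r - ((q \<bullet> y) * r) * ((y \<bullet> a) * r) * r"
        by (simp add: dheight_def q_def y_def r_def a_def b_def algebra_simps power3_eq_cube)
      also have "\<bar>\<dots>\<bar> \<le> \<bar>q \<bullet> a * r\<bar> + \<bar>b \<bullet> y * r\<bar> + \<bar>((q \<bullet> y) * r) * ((y \<bullet> a) * r) * r\<bar>" by linarith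
      finally show ?thesis using r by (simp add: abs_mult)
    qed
    also have "\<dots> \<le> norm a * 1 + norm b * norm y * r + (norm y * r) * (norm y * norm a * r) * 1"
      using r r1 n1 by (intro add_mono mult_mono) auto
    also have "\<dots> = norm a + norm b * (r * norm y) + (r * norm y) * ((r * norm y) * norm a)"
      by (simp add: mult_ac)
    also have "\<dots> \<le> norm a + norm b * 1 + 1 * (1 * norm a)"
      using r ry by (intro add_mono mult_mono order_refl) auto
    also have "\<dots> \<le> norm v * K + norm v + norm v * K"
    proof -
      have "norm a \<le> norm (snd v) * K" by (simp add: a_def K)
      also have "\<dots> \<le> norm v * K"
        using norm_snd_le[of "snd v" "fst v"] K(1) by (intro mult_right_mono) auto
      finally show ?thesis using norm_fst_le[of "fst v" "snd v"] by (simp add: b_def mult.commute)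
    qed
    also have "\<dots> = M * norm v" by (simp add: M_def algebra_simps)
    finally show ?thesis .
  qed
  have im: "\<bar>Im (snd v $ j)\<bar> \<le> norm v" for v :: "(real ^ 3) \<times> (complex ^ 'n)"
    using abs_Im_le_cmod[of "snd v $ j"] Finite_Cartesian_Product.norm_nth_le[of "snd v" j] norm_snd_le[of "snd v" "fst v"]
    by simp
  have "\<bar>wide_form p v w\<bar> \<le> (\<bar>B\<bar> + 2 * M) * norm v * norm w" if "p \<in> S2_R2n" for p v w
  proof -
    have "wide_form p v w = h v w + dheight p v * Im (snd w $ j) - dheight p w * Im (snd v $ j)"
      by (simp add: wide_form_def h_def)
    also have "\<bar>\<dots>\<bar> \<le> \<bar>h v w\<bar> + \<bar>dheight p v\<bar> * \<bar>Im (snd w $ j)\<bar> + \<bar>dheight p w\<bar> * \<bar>Im (snd v $ j)\<bar>"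
      unfolding abs_mult[symmetric] by linarith
    also have "\<dots> \<le> \<bar>B\<bar> * norm v * norm w + (M * norm v) * norm w + (M * norm w) * norm v"
      using K(1) by (intro add_mono mult_mono B dh im that) (auto simp: M_def)
    finally show ?thesis by (simp add: algebra_simps)
  qed
  moreover have "\<bar>B\<bar> + 2 * M \<ge> 0" using K(1) by (simp add: M_def)
  ultimately show ?thesis by blast
qed

end

text \<open>Inverse to splitting a vector of \<complex>^n into y, t and the remaining coordinates.\<close>

definition assemble :: "'n::finite \<Rightarrow> 'n \<Rightarrow> real ^ 3 \<Rightarrow> real \<Rightarrow> ('n \<Rightarrow> complex) \<Rightarrow> complex ^ 'n" where
  "assemble i j u t \<zeta> = (\<chi> l. if l = i then Complex (u $ 1) (u $ 2) else if l = j then Complex (u $ 3) t else \<zeta> l)"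

lemma assemble_simps:
  assumes "i \<noteq> j"
  shows "yvec i j (assemble i j u t \<zeta>) = u" and "Im (assemble i j u t \<zeta> $ j) = t"
    and "k \<noteq> i \<Longrightarrow> k \<noteq> j \<Longrightarrow> assemble i j u t \<zeta> $ k = \<zeta> k"
  using assms by (simp_all add: assemble_def yvec_def vec_eq_iff forall_3)

lemma assemble_eqI:
  assumes "yvec i j z = u" "Im (z $ j) = t" "\<And>k. k \<noteq> i \<Longrightarrow> k \<noteq> j \<Longrightarrow> z $ k = \<zeta> k"
  shows "z = assemble i j u t \<zeta>"
  using assms by (auto simp: assemble_def yvec_def vec_eq_iff complex_eq_iff forall_3)

lemma tangent_space_S2_R2n:
  assumes "p \<in> (S2_R2n :: ((real ^ 3) \<times> (complex ^ 'n)) set)"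
  shows "tangent_space S2_R2n p = {v :: (real ^ 3) \<times> (complex ^ 'n). fst p \<bullet> fst v = 0}"
proof -
  have "fst p \<in> S2" using assms by (auto simp: S2_R2n_def)
  then show ?thesis
    using tangent_space_times_UNIV[of S2 "fst p" "snd p"] tangent_space_sphere[of "fst p"]
    by (auto simp: S2_R2n_def)
qed

text \<open>The derivative of \<tau> when y moves in the direction q, that is, along the normal coordinate s. Its
positivity is the reason why \<tau> can replace s as a coordinate.\<close>

lemma normal_height_pos:
  assumes "q \<bullet> q = 1"
  shows "inv_radius i j (q, z) - (q \<bullet> yvec i j z)\<^sup>2 * inv_radius i j (q, z) ^ 3 > 0"
proof -
  define r y where "r = inv_radius i j (q, z)" and "y = yvec i j z"
  have r: "r > 0" "r\<^sup>2 * (1 + y \<bullet> y) = 1"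
    using inv_radius_pos inv_radius_sq[of i j "(q, z)"] by (simp_all add: r_def y_def)
  have "(q \<bullet> y)\<^sup>2 \<le> y \<bullet> y"
    using Cauchy_Schwarz_ineq[of q y] assms by simp
  then have "0 < r ^ 3 * ((1 + y \<bullet> y) - (q \<bullet> y)\<^sup>2)"
    using r(1) by simp
  also have "\<dots> = r * (r\<^sup>2 * (1 + y \<bullet> y)) - (q \<bullet> y)\<^sup>2 * r ^ 3"
    by (simp add: algebra_simps power2_eq_square power3_eq_cube)
  finally show ?thesis using r(2) by (simp add: r_def y_def)
qed

text \<open>Let v, a, t be the components of V in the directions of q, y, t. Contracting V with the directions
dt, then dy, gives d\<tau>(V) = 0 and that v is - t times the gradient of \<tau> in y; as v is tangent to the sphere
while the normal component of that gradient is positive, t and v vanish. Contracting with directions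
tangent to the sphere shows a to be a multiple of q, which d\<tau>(V) = 0 makes zero by the same positivity.\<close>

lemma nondegenerate_wide_form:
  fixes i j :: "'n::finite"
  assumes ij: "i \<noteq> j"
  shows "nondegenerate_form2 S2_R2n (wide_form i j)"
  unfolding nondegenerate_form2_def
proof (intro ballI impI)
  fix p V :: "(real ^ 3) \<times> (complex ^ 'n)"
  assume p: "p \<in> S2_R2n" and "V \<in> tangent_space S2_R2n p"
    and "\<forall>W\<in>tangent_space S2_R2n p. wide_form i j p V W = 0"
  then have V: "fst p \<bullet> fst V = 0"
    and test: "\<And>W. fst p \<bullet> fst W = 0 \<Longrightarrow> wide_form i j p V W = 0"
    by (auto simp: tangent_space_S2_R2n)
  define q y r where "q = fst p" and "y = yvec i j (snd p)" and "r = inv_radius i j p"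
  define v a t where "v = fst V" and "a = yvec i j (snd V)" and "t = Im (snd V $ j)"
  have qq: "q \<bullet> q = 1" using p by (auto simp: q_def S2_R2n_def dot_square_norm)
  have qv: "q \<bullet> v = 0" using V by (simp add: q_def v_def)
  have pos: "r - (q \<bullet> y)\<^sup>2 * r ^ 3 > 0"
    using normal_height_pos[OF qq, of i j "snd p"] by (simp add: q_def r_def y_def)
  have vertical: "- (u \<bullet> v) + dheight i j p V * c - (q \<bullet> u * r - q \<bullet> y * (y \<bullet> u) * r ^ 3) * t
      + (\<Sum>k\<in>- {i, j}. Re (snd V $ k) * Im (\<zeta> k) - Im (snd V $ k) * Re (\<zeta> k)) = 0" for u c \<zeta>
  proof -
    have "(\<Sum>k\<in>- {i, j}. Re (snd V $ k) * Im (assemble i j u c \<zeta> $ k) - Im (snd V $ k) * Re (assemble i j u c \<zeta> $ k))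
      = (\<Sum>k\<in>- {i, j}. Re (snd V $ k) * Im (\<zeta> k) - Im (snd V $ k) * Re (\<zeta> k))"
      using ij by (intro sum.cong refl) (simp add: assemble_simps)
    then show ?thesis
      using test[of "(0, assemble i j u c \<zeta>)"] ij
      by (simp add: wide_form_def dheight_def[of i j p "(0, _)"] assemble_simps q_def v_def y_def r_def t_def)
  qed
  have dV: "dheight i j p V = 0" using vertical[of 0 1 "\<lambda>_. 0"] by simp
  have "(r - (q \<bullet> y)\<^sup>2 * r ^ 3) * t = 0"
    using vertical[of q 0 "\<lambda>_. 0"] qq qv by (auto simp: inner_commute power2_eq_square algebra_simps)
  then have t: "t = 0" using pos by simp
  then have v: "v = 0" using vertical[of v 0 "\<lambda>_. 0"] dV by simp
  have horizontal: "a \<bullet> u = 0" if "q \<bullet> u = 0" for u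
    using test[of "(u, 0)"] that t by (simp add: wide_form_def q_def a_def t_def yvec_0 dV)
  define c where "c = q \<bullet> a"
  have "q \<bullet> (a - c *\<^sub>R q) = 0" by (simp add: c_def inner_diff_right qq)
  then have "(a - c *\<^sub>R q) \<bullet> (a - c *\<^sub>R q) = 0"
    using horizontal[of "a - c *\<^sub>R q"] by (simp add: inner_diff_left)
  then have aq: "a = c *\<^sub>R q" by simp
  have "c * (r - (q \<bullet> y)\<^sup>2 * r ^ 3) = 0"
    using dV v aq qq unfolding dheight_def a_def[symmetric] v_def[symmetric] q_def[symmetric]
      y_def[symmetric] r_def[symmetric]
    by (simp add: inner_commute power2_eq_square algebra_simps)
  then have a: "a = 0" using pos aq by simp
  have rest: "snd V $ k = 0" if k: "k \<noteq> i" "k \<noteq> j" for k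
  proof -
    have *: "Re (snd V $ k) * Im c - Im (snd V $ k) * Re c = 0" for c
    proof -
      have "(\<Sum>l\<in>- {i, j}. Re (snd V $ l) * Im (if l = k then c else 0) - Im (snd V $ l) * Re (if l = k then c else 0))
        = (\<Sum>l\<in>- {i, j}. if l = k then Re (snd V $ k) * Im c - Im (snd V $ k) * Re c else 0)"
        by (intro sum.cong) auto
      then show ?thesis using vertical[of 0 0 "\<lambda>l. if l = k then c else 0"] k by simp
    qed
    from *[of \<i>] *[of 1] show ?thesis by (simp add: complex_eq_iff)
  qed
  have "snd V = assemble i j 0 0 (\<lambda>_. 0)"
    using a t rest by (intro assemble_eqI) (auto simp: a_def t_def)
  moreover have "0 = assemble i j 0 0 (\<lambda>_. 0)"
    by (intro assemble_eqI) (auto simp: yvec_0)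
  ultimately show "V = 0"
    using v by (simp add: v_def prod_eq_iff)
qed

lemma symplectic_wide_form:
  assumes "i \<noteq> j"
  shows "symplectic_form S2_R2n (wide_form i j)"
proof -
  have "local_extension S2_R2n (wide_form i j) UNIV (wide_form i j)"
    using smooth_form2_on_wide_form[of i j] by (simp add: local_extension_def)
  then show ?thesis
    unfolding symplectic_form_def smooth_form2_def closed_form2_def
    using nondegenerate_wide_form[OF assms] ext_deriv_wide_form by blast
qed

section \<open>Finite comass of bounded perturbations\<close>

text \<open>Comass is tested on arbitrary bases of unit area, whose vectors may be long. Subtracting from w its
projection to v changes neither the value of E nor the area, and makes the area a product of lengths.\<close>

lemma bilinear_le_gram:
  fixes E G :: "'a::real_normed_vector \<Rightarrow> 'a \<Rightarrow> real"
  assumes E: "bilinear E" "\<And>v. E v v = 0" "\<And>v w. \<bar>E v w\<bar> \<le> K * norm v * norm w"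
    and G: "bilinear G" "\<And>v w. G v w = G w v" "\<And>v. m * (norm v)\<^sup>2 \<le> G v v" "m > 0"
    and gram: "G v v * G w w - (G v w)\<^sup>2 = 1" and K: "K \<ge> 0"
  shows "E v w \<le> K / m"
proof -
  have "v \<noteq> 0"
    using gram bilinear_lzero[OF G(1)] by auto
  then have "0 < m * (norm v)\<^sup>2" using G(4) by simp
  then have Gv: "G v v > 0" using G(3)[of v] by linarith
  define c where "c = G v w / G v v"
  define w' where "w' = w - c *\<^sub>R v"
  note blG = bilinear_lsub[OF G(1)] bilinear_rsub[OF G(1)] bilinear_lmul[OF G(1)] bilinear_rmul[OF G(1)]
  have "G w' w' = G w w - c * G v w - c * (G v w - c * G v v)"
    using G(2)[of w v] by (simp add: w'_def blG)
  also have "c * G v v = G v w" using Gv by (simp add: c_def)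
  finally have "G w' w' = G w w - c * G v w" by simp
  then have "G v v * G w' w' = G v v * G w w - (c * G v v) * G v w"
    by (simp add: right_diff_distrib mult_ac)
  then have one: "G v v * G w' w' = 1"
    using gram Gv by (simp add: c_def power2_eq_square)
  have "(m * (norm v * norm w'))\<^sup>2 = (m * (norm v)\<^sup>2) * (m * (norm w')\<^sup>2)"
    by (simp add: power_mult_distrib power2_eq_square mult_ac)
  also have "\<dots> \<le> G v v * G w' w'"
    using G(4) Gv by (intro mult_mono G(3)) auto
  also have "\<dots> = 1\<^sup>2" using one by simp
  finally have nn: "m * (norm v * norm w') \<le> 1"
    by (rule power2_le_imp_le) simp
  have "E v w = E v w'"
    by (simp add: w'_def bilinear_rsub[OF E(1)] bilinear_rmul[OF E(1)] E(2))
  also have "\<dots> \<le> K * (norm v * norm w')"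
    using E(3)[of v w'] by (simp add: mult.assoc)
  also have "\<dots> \<le> K * (1 / m)"
    using nn G(4) K by (intro mult_left_mono) (simp_all add: field_simps)
  finally show ?thesis by simp
qed

lemma bilinear_omega_std: "bilinear omega_std"
  unfolding bilinear_def omega_std_def
  by (intro conjI allI linearI)
     (simp_all add: algebra_simps sum.distrib sum_subtractf sum_distrib_left)

lemma omega_std_i: "omega_std z (\<i> *s w) = z \<bullet> w"
  by (simp add: omega_std_def inner_vec_def inner_complex_def)

lemma omega_std_self: "omega_std z z = 0"
  by (simp add: omega_std_def)

lemma bilinear_diff: "bilinear f \<Longrightarrow> bilinear g \<Longrightarrow> bilinear (\<lambda>v w. f v w - g v w)"
  unfolding bilinear_def by (auto intro: linear_compose_sub)

text \<open>On tangent vectors both \<omega>0 and g0 are given by expressions \<open>h\<close> and \<open>G\<close> that are bilinear in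
all vectors, with the area factor \<mu> as only variable coefficient. Since \<mu> is bounded and bounded away
from zero, g0 is comparable with the Euclidean metric and \<open>bilinear_le_gram\<close> applies.\<close>

lemma comass_diff_omega0_finite:
  fixes \<omega> :: "((real ^ 3) \<times> (complex ^ 'n::finite)) form2"
  assumes \<sigma>: "smooth_form2 S2 \<sigma>" "compatible_S2 \<sigma>"
    and bil: "\<And>p. bilinear (\<omega> p)" and alt: "\<And>p v. \<omega> p v v = 0"
    and bound: "\<And>p v w. p \<in> S2_R2n \<Longrightarrow> \<bar>\<omega> p v w\<bar> \<le> C * norm v * norm w" and C: "C \<ge> 0"
  shows "\<bar>comass S2_R2n (g0 \<sigma>) (\<lambda>p v w. \<omega> p v w - omega0 \<sigma> p v w)\<bar> \<noteq> \<infinity>"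
proof -
  obtain \<mu> where cont: "continuous_on S2 \<mu>"
    and area: "\<And>q v w. q \<in> S2 \<Longrightarrow> q \<bullet> v = 0 \<Longrightarrow> q \<bullet> w = 0 \<Longrightarrow> \<sigma> q v w = \<mu> q * (q \<bullet> cross3 v w)"
    using form2_on_S2_eq_area[OF \<sigma>(1)] by blast
  have metric: "\<sigma> q v (J_S2 q w) = \<mu> q * (v \<bullet> w)"
    if "q \<in> S2" "q \<bullet> v = 0" "q \<bullet> w = 0" for q v w
  proof -
    have "q \<bullet> q = 1" using that by (simp add: dot_square_norm)
    moreover have "cross3 v (cross3 q w) = (v \<bullet> w) *\<^sub>R q"
      unfolding Lagrange using that by (simp add: inner_commute)
    ultimately show ?thesis
      using area[of q v "cross3 q w"] that by (simp add: J_S2_def dot_cross_self)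
  qed
  have pos: "\<mu> q > 0" if q: "q \<in> S2" for q
  proof -
    obtain u where u: "u \<noteq> 0" "q \<bullet> u = 0"
      using orthogonal_to_vector_exists[of q] by (auto simp: orthogonal_def)
    then have "0 < \<sigma> q u (J_S2 q u)"
      using \<sigma>(2) q tangent_space_sphere[OF q] unfolding compatible_S2_def by blast
    then show ?thesis
      using metric[OF q u(2) u(2)] u(1) zero_less_mult_pos2[of "\<mu> q" "u \<bullet> u"] by simp
  qed
  have S2: "compact S2" "S2 \<noteq> {}" by auto
  obtain q0 where q0: "q0 \<in> S2" "\<And>q. q \<in> S2 \<Longrightarrow> \<mu> q0 \<le> \<mu> q"
    using continuous_attains_inf[OF S2 cont] by blast
  obtain q1 where q1: "q1 \<in> S2" "\<And>q. q \<in> S2 \<Longrightarrow> \<mu> q \<le> \<mu> q1"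
    using continuous_attains_sup[OF S2 cont] by blast
  obtain B where "\<And>v w :: complex ^ 'n. norm (omega_std v w) \<le> B * norm v * norm w"
    using bilinear_bounded[OF bilinear_omega_std] by blast
  then have B: "\<bar>omega_std v w\<bar> \<le> \<bar>B\<bar> * norm v * norm w" for v w :: "complex ^ 'n"
    by (smt (verit) mult_right_mono norm_ge_zero real_norm_def)
  define m where "m = min (\<mu> q0) 1"
  define K where "K = C + (\<mu> q1 + \<bar>B\<bar>)"
  have m: "m > 0" using pos[OF q0(1)] by (simp add: m_def)
  have K: "K \<ge> 0" using C pos[OF q1(1)] by (simp add: K_def)
  define h where "h p v w = \<mu> (fst p) * (fst p \<bullet> cross3 (fst v) (fst w)) + omega_std (snd v) (snd w)"
    for p v w :: "(real ^ 3) \<times> (complex ^ 'n)"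
  define G where "G p v w = \<mu> (fst p) * (fst v \<bullet> fst w) + snd v \<bullet> snd w"
    for p v w :: "(real ^ 3) \<times> (complex ^ 'n)"
  have h: "omega0 \<sigma> p v w = h p v w"
    if "p \<in> S2_R2n" "v \<in> tangent_space S2_R2n p" "w \<in> tangent_space S2_R2n p" for p v w
    using that area[of "fst p" "fst v" "fst w"]
    by (auto simp: omega0_def h_def tangent_space_S2_R2n) (auto simp: S2_R2n_def)
  have G: "g0 \<sigma> p v w = G p v w"
    if "p \<in> S2_R2n" "v \<in> tangent_space S2_R2n p" "w \<in> tangent_space S2_R2n p" for p v w
    using that metric[of "fst p" "fst v" "fst w"]
    by (auto simp: g0_def omega0_def J0_def G_def omega_std_i tangent_space_S2_R2n) (auto simp: S2_R2n_def)
  have hb: "\<bar>h p v w\<bar> \<le> (\<mu> q1 + \<bar>B\<bar>) * norm v * norm w" if p: "p \<in> S2_R2n" for p v w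
  proof -
    have q: "fst p \<in> S2" using p by (auto simp: S2_R2n_def)
    note n = norm_fst_le[of "fst v" "snd v"] norm_fst_le[of "fst w" "snd w"]
      norm_snd_le[of "snd v" "fst v"] norm_snd_le[of "snd w" "fst w"]
    have "\<bar>fst p \<bullet> cross3 (fst v) (fst w)\<bar> \<le> norm (cross3 (fst v) (fst w))"
      using Cauchy_Schwarz_ineq2[of "fst p"] q by simp
    also have "\<dots> \<le> norm (fst v) * norm (fst w)"
    proof (rule power2_le_imp_le)
      show "(norm (cross3 (fst v) (fst w)))\<^sup>2 \<le> (norm (fst v) * norm (fst w))\<^sup>2"
        using norm_cross_dot[of "fst v" "fst w"] zero_le_power2[of "fst v \<bullet> fst w"] by linarith
    qed simp
    also have "\<dots> \<le> norm v * norm w" using n by (intro mult_mono) auto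
    finally have "\<mu> (fst p) * \<bar>fst p \<bullet> cross3 (fst v) (fst w)\<bar> \<le> \<mu> q1 * (norm v * norm w)"
      using q1(2)[OF q] pos[OF q1(1)] by (intro mult_mono) auto
    moreover have "\<bar>omega_std (snd v) (snd w)\<bar> \<le> \<bar>B\<bar> * norm v * norm w"
      by (rule order_trans[OF B]) (use n in \<open>intro mult_mono; auto\<close>)
    ultimately show ?thesis
      using pos[OF q] abs_triangle_ineq[of "\<mu> (fst p) * (fst p \<bullet> cross3 (fst v) (fst w))" "omega_std (snd v) (snd w)"]
      by (simp add: h_def abs_mult algebra_simps)
  qed
  have upper: "\<omega> p v w - omega0 \<sigma> p v w \<le> K / m"
    if p: "p \<in> S2_R2n" and v: "v \<in> tangent_space S2_R2n p" and w: "w \<in> tangent_space S2_R2n p"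
      and gram: "sqrt (g0 \<sigma> p v v * g0 \<sigma> p w w - (g0 \<sigma> p v w)\<^sup>2) = 1" for p v w
  proof -
    have q: "fst p \<in> S2" using p by (auto simp: S2_R2n_def)
    have bh: "bilinear (h p)"
      unfolding bilinear_def h_def
      by (intro conjI allI linearI)
         (simp_all add: cross_add_left cross_add_right cross_mult_left cross_mult_right inner_add_right
           bilinear_ladd[OF bilinear_omega_std] bilinear_radd[OF bilinear_omega_std]
           bilinear_lmul[OF bilinear_omega_std] bilinear_rmul[OF bilinear_omega_std] algebra_simps)
    have "\<omega> p v w - h p v w \<le> K / m"
    proof (rule bilinear_le_gram[where G = "G p"])
      show "bilinear (\<lambda>v w. \<omega> p v w - h p v w)" by (rule bilinear_diff[OF bil bh])
      show "\<omega> p v v - h p v v = 0" for v by (simp add: alt h_def omega_std_self)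
      show "\<bar>\<omega> p v w - h p v w\<bar> \<le> K * norm v * norm w" for v w
      proof -
        have "\<bar>\<omega> p v w - h p v w\<bar> \<le> \<bar>\<omega> p v w\<bar> + \<bar>h p v w\<bar>" by linarith
        also have "\<dots> \<le> C * norm v * norm w + (\<mu> q1 + \<bar>B\<bar>) * norm v * norm w"
          by (intro add_mono bound hb p)
        finally show ?thesis by (simp add: K_def algebra_simps)
      qed
      show "bilinear (G p)"
        unfolding bilinear_def G_def
        by (intro conjI allI linearI) (simp_all add: inner_add_left inner_add_right algebra_simps)
      show "G p v w = G p w v" for v w by (simp add: G_def inner_commute)
      show "m * (norm v)\<^sup>2 \<le> G p v v" for v
      proof -
        have "m * (norm v)\<^sup>2 = m * (fst v \<bullet> fst v) + m * (snd v \<bullet> snd v)"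
          by (simp add: power2_norm_eq_inner inner_prod_def algebra_simps)
        also have "\<dots> \<le> \<mu> (fst p) * (fst v \<bullet> fst v) + 1 * (snd v \<bullet> snd v)"
          using q0(2)[OF q] by (intro add_mono mult_right_mono) (auto simp: m_def)
        finally show ?thesis by (simp add: G_def)
      qed
      show "G p v v * G p w w - (G p v w)\<^sup>2 = 1"
        using gram G[OF p] v w by simp
    qed (fact m K)+
    then show ?thesis using h[OF p v w] by simp
  qed
  \<comment> \<open>A pair of unit area shows that the supremum is not that of the empty set, which would be \<open>-\<infinity>\<close>.\<close>
  obtain i :: 'n where True by simp
  define p :: "(real ^ 3) \<times> (complex ^ 'n)" where "p = (q0, 0)"
  define v w :: "(real ^ 3) \<times> (complex ^ 'n)" where "v = (0, axis i 1)" and "w = (0, axis i \<i>)"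
  have p: "p \<in> S2_R2n" using q0(1) by (simp add: p_def S2_R2n_def)
  have vw: "v \<in> tangent_space S2_R2n p" "w \<in> tangent_space S2_R2n p"
    by (simp_all add: tangent_space_S2_R2n[OF p] v_def w_def)
  have "sqrt (g0 \<sigma> p v v * g0 \<sigma> p w w - (g0 \<sigma> p v w)\<^sup>2) = 1"
    using vw by (simp add: G[OF p] G_def v_def w_def inner_axis_axis)
  then have "ereal (\<omega> p v w - omega0 \<sigma> p v w) \<le> comass S2_R2n (g0 \<sigma>) (\<lambda>p v w. \<omega> p v w - omega0 \<sigma> p v w)"
    unfolding comass_def using p vw by (intro Sup_upper) blast
  moreover have "comass S2_R2n (g0 \<sigma>) (\<lambda>p v w. \<omega> p v w - omega0 \<sigma> p v w) \<le> ereal (K / m)"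
    unfolding comass_def using upper by (intro Sup_least) auto
  ultimately show ?thesis by auto
qed

section \<open>A symplectic embedding of the whole linear space\<close>

lemma has_derivative_chain_unique:
  assumes "(f has_derivative f') (at x)" "(g has_derivative g') (at (f x))"
    and "((\<lambda>x. g (f x)) has_derivative h') (at x)"
  shows "g' (f' v) = h' v"
  using has_derivative_unique[OF has_derivative_compose[OF assms(1,2)] assms(3)] by metis

lemma has_derivative_linear_unique:
  assumes "(f has_derivative f') (at x)" "bounded_linear L"
    and "((\<lambda>x. L (f x)) has_derivative h') (at x)"
  shows "L (f' v) = h' v"
  using has_derivative_chain_unique[OF assms(1) bounded_linear_imp_has_derivative[OF assms(2)] assms(3)] .

context
  fixes i j :: "'n::finite"
  assumes ij: "i \<noteq> j"
begin

text \<open>The open upper hemisphere is parametrized by central projection from the plane at height 1: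
(x1, x2) goes to X / |X| with X = (x1, x2, 1). In coordinate \<open>Some i\<close> the momentum \<xi>1 is the real part
and x1 the imaginary part, because \<open>wide_form\<close> pairs dy before dq.\<close>

definition gnomonic_vec :: "complex ^ ('n option) \<Rightarrow> real ^ 3" where
  "gnomonic_vec x = vector [Im (x $ Some i), Im (x $ Some j), 1]"

text \<open>The vector orthogonal to X that represents \<xi>1 dx1 + \<xi>2 dx2. Scaled by |X| it becomes the
cotangent vector p of the sphere at q = X / |X| with p \<cdot> dq = \<xi>1 dx1 + \<xi>2 dx2.\<close>

definition covec :: "complex ^ ('n option) \<Rightarrow> real ^ 3" where
  "covec x = vector [Re (x $ Some i), Re (x $ Some j),
     - (Re (x $ Some i) * Im (x $ Some i) + Re (x $ Some j) * Im (x $ Some j))]"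

definition gnomonic :: "complex ^ ('n option) \<Rightarrow> real ^ 3" where
  "gnomonic x = inverse (norm (gnomonic_vec x)) *\<^sub>R gnomonic_vec x"

definition momentum :: "complex ^ ('n option) \<Rightarrow> real ^ 3" where
  "momentum x = norm (gnomonic_vec x) *\<^sub>R covec x"

text \<open>With a the real part of the coordinate \<open>None\<close>, this choice of s = q \<cdot> y makes
\<tau> = a / sqrt (1 + a^2), independently of p.\<close>

definition normal_part :: "complex ^ ('n option) \<Rightarrow> real" where
  "normal_part x = Re (x $ None) * sqrt (1 + momentum x \<bullet> momentum x)"

definition ambient :: "complex ^ ('n option) \<Rightarrow> real ^ 3" where
  "ambient x = momentum x + normal_part x *\<^sub>R gnomonic x"

definition strip_scale :: "complex ^ ('n option) \<Rightarrow> real" where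
  "strip_scale x = sqrt (1 + (Re (x $ None))\<^sup>2)"

text \<open>The strip is straightened by \<tau> = a / sqrt (1 + a^2) and t = b (1 + a^2)^(3/2) with b the
imaginary part of the coordinate \<open>None\<close>; the exponent is chosen so that d\<tau> \<and> dt = da \<and> db.\<close>

definition wide_map :: "complex ^ ('n option) \<Rightarrow> (real ^ 3) \<times> (complex ^ 'n)" where
  "wide_map x = (gnomonic x, assemble i j (ambient x) (Im (x $ None) * strip_scale x ^ 3) (\<lambda>k. x $ Some k))"

lemma norm_gnomonic_vec_pos: "norm (gnomonic_vec x) > 0"
proof -
  have "gnomonic_vec x $ 3 \<noteq> 0" by (simp add: gnomonic_vec_def)
  then show ?thesis by auto
qed

lemma gnomonic_vec_orth: "gnomonic_vec x \<bullet> covec x = 0"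
  by (simp add: gnomonic_vec_def covec_def inner_vec_def sum_3)

lemma gnomonic_unit: "gnomonic x \<bullet> gnomonic x = 1"
proof -
  have "norm (gnomonic x) = 1" using norm_gnomonic_vec_pos[of x] by (simp add: gnomonic_def)
  then show ?thesis by (simp add: norm_eq_1)
qed

lemma gnomonic_momentum: "gnomonic x \<bullet> momentum x = 0"
  by (simp add: gnomonic_def momentum_def gnomonic_vec_orth)

lemma gnomonic_ambient: "gnomonic x \<bullet> ambient x = normal_part x"
  by (simp add: ambient_def inner_add_right gnomonic_momentum gnomonic_unit)

lemma strip_scale_pos: "strip_scale x > 0" and strip_scale_sq: "strip_scale x ^ 2 = 1 + (Re (x $ None))\<^sup>2"
  by (simp_all add: strip_scale_def add_pos_nonneg)

lemma ambient_sq: "sqrt (1 + ambient x \<bullet> ambient x) = sqrt (1 + momentum x \<bullet> momentum x) * strip_scale x"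
proof -
  have "ambient x \<bullet> ambient x = momentum x \<bullet> momentum x + (normal_part x)\<^sup>2"
    by (simp add: ambient_def inner_add_left inner_add_right gnomonic_unit gnomonic_momentum
        inner_commute[of "momentum x" "gnomonic x"] power2_eq_square)
  moreover have "(normal_part x)\<^sup>2 = (Re (x $ None))\<^sup>2 * (1 + momentum x \<bullet> momentum x)"
    by (simp add: normal_part_def power_mult_distrib)
  ultimately have "1 + ambient x \<bullet> ambient x = (1 + momentum x \<bullet> momentum x) * (1 + (Re (x $ None))\<^sup>2)"
    by (simp add: algebra_simps)
  then show ?thesis by (simp add: strip_scale_def real_sqrt_mult)
qed

lemma wide_map_simps:
  shows "fst (wide_map x) = gnomonic x" and "yvec i j (snd (wide_map x)) = ambient x"
    and "Im (snd (wide_map x) $ j) = Im (x $ None) * strip_scale x ^ 3"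
    and "k \<noteq> i \<Longrightarrow> k \<noteq> j \<Longrightarrow> snd (wide_map x) $ k = x $ Some k"
  using ij by (simp_all add: wide_map_def assemble_simps)

lemma height_wide_map: "height i j (wide_map x) = Re (x $ None) * inverse (strip_scale x)"
proof -
  have "sqrt (1 + momentum x \<bullet> momentum x) > 0" by (simp add: add_pos_nonneg)
  then show ?thesis
    by (simp add: height_def inv_radius_def wide_map_simps gnomonic_ambient ambient_sq normal_part_def)
qed

lemma bounded_linear_Re_nth: "bounded_linear (\<lambda>x :: complex ^ 'm. Re (x $ l))"
  by (rule bounded_linear_compose[OF bounded_linear_Re bounded_linear_vec_nth])

lemma bounded_linear_Im_nth: "bounded_linear (\<lambda>x :: complex ^ 'm. Im (x $ l))"
  by (rule bounded_linear_compose[OF bounded_linear_Im bounded_linear_vec_nth])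

lemmas coord_derivative =
  bounded_linear_imp_has_derivative[OF bounded_linear_Re_nth]
  bounded_linear_imp_has_derivative[OF bounded_linear_Im_nth]

lemma smooth_coords:
  "smooth_on UNIV (\<lambda>x :: complex ^ 'm. Re (x $ l))"
  "smooth_on UNIV (\<lambda>x :: complex ^ 'm. Im (x $ l))"
  by (rule smooth_on_linear[OF open_UNIV bounded_linear_Re_nth]
      smooth_on_linear[OF open_UNIV bounded_linear_Im_nth])+

lemma smooth_gnomonic_vec: "smooth_on UNIV gnomonic_vec"
proof (rule smooth_on_vec[OF open_UNIV])
  have "\<forall>l. smooth_on UNIV (\<lambda>x. gnomonic_vec x $ l)"
    by (simp add: forall_3 gnomonic_vec_def smooth_coords smooth_on_const)
  then show "smooth_on UNIV (\<lambda>x. gnomonic_vec x $ l)" for l ..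
qed

lemma smooth_covec: "smooth_on UNIV covec"
proof (rule smooth_on_vec[OF open_UNIV])
  have "\<forall>l. smooth_on UNIV (\<lambda>x. covec x $ l)"
    unfolding forall_3 covec_def vector_3
    by (intro conjI smooth_on_minus smooth_on_add smooth_on_mult smooth_coords open_UNIV)
  then show "smooth_on UNIV (\<lambda>x. covec x $ l)" for l ..
qed

lemma smooth_norm_gnomonic_vec: "smooth_on UNIV (\<lambda>x. norm (gnomonic_vec x))"
  unfolding norm_eq_sqrt_inner
proof (rule smooth_on_sqrt[OF open_UNIV])
  show "gnomonic_vec x \<bullet> gnomonic_vec x > 0" for x using norm_gnomonic_vec_pos[of x] by simp
qed (intro smooth_on_inner smooth_gnomonic_vec open_UNIV)

lemma smooth_gnomonic: "smooth_on UNIV gnomonic"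
  unfolding gnomonic_def using norm_gnomonic_vec_pos
  by (intro smooth_on_scaleR smooth_on_inverse smooth_norm_gnomonic_vec smooth_gnomonic_vec open_UNIV)
     (metis less_irrefl)

lemma smooth_momentum: "smooth_on UNIV momentum"
  unfolding momentum_def
  by (intro smooth_on_scaleR smooth_norm_gnomonic_vec smooth_covec open_UNIV)

lemma smooth_normal_part: "smooth_on UNIV normal_part"
  unfolding normal_part_def
  by (intro smooth_on_mult smooth_on_sqrt smooth_on_add smooth_on_const smooth_on_inner
      smooth_momentum smooth_coords open_UNIV) (simp add: add_pos_nonneg)

lemma smooth_ambient: "smooth_on UNIV ambient"
  unfolding ambient_def
  by (intro smooth_on_add smooth_on_scaleR smooth_momentum smooth_normal_part smooth_gnomonic open_UNIV)

lemma smooth_strip_scale: "smooth_on UNIV strip_scale"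
  unfolding strip_scale_def
  by (intro smooth_on_sqrt smooth_on_add smooth_on_const smooth_on_power smooth_coords open_UNIV)
     (simp add: add_pos_nonneg)

lemma smooth_nth:
  fixes f :: "'b::real_normed_vector \<Rightarrow> 'c::real_normed_vector ^ 'm::finite"
  shows "smooth_on UNIV f \<Longrightarrow> smooth_on UNIV (\<lambda>x. f x $ l)"
  by (rule smooth_on_compose_linear[OF open_UNIV bounded_linear_vec_nth])

lemma smooth_wide_map: "smooth_on UNIV wide_map"
  unfolding wide_map_def
proof (intro smooth_on_Pair smooth_gnomonic open_UNIV smooth_on_vec)
  fix l
  show "smooth_on UNIV (\<lambda>x. assemble i j (ambient x) (Im (x $ None) * strip_scale x ^ 3) (\<lambda>k. x $ Some k) $ l)"
    using ij by (cases "l = i"; cases "l = j")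
       (simp_all add: assemble_def smooth_on_Complex smooth_nth smooth_ambient smooth_on_mult
        smooth_on_power smooth_strip_scale smooth_coords smooth_on_linear[OF open_UNIV bounded_linear_vec_nth])
qed

lemma sum_option_split:
  fixes F :: "'n option \<Rightarrow> real"
  shows "sum F UNIV = F None + (F (Some i) + F (Some j) + (\<Sum>k\<in>- {i, j}. F (Some k)))"
proof -
  have "sum F UNIV = F None + (\<Sum>k\<in>UNIV. F (Some k))"
    by (simp add: UNIV_option_conv sum.reindex)
  also have "(\<Sum>k\<in>UNIV. F (Some k)) = (\<Sum>k\<in>{i, j} \<union> - {i, j}. F (Some k))"
    by (simp add: Compl_partition)
  also have "\<dots> = (\<Sum>k\<in>{i, j}. F (Some k)) + (\<Sum>k\<in>- {i, j}. F (Some k))"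
    by (intro sum.union_disjoint) auto
  finally show ?thesis using ij by simp
qed

text \<open>The part d(y \<cdot> dq) sees only p, since q \<cdot> dq = 0 and dq \<cdot> dq is symmetric; it pulls back to
d\<xi> \<and> dx because the terms with the derivative of |X| cancel. The part d\<tau> \<and> dt becomes da \<and> db. The
values of the derivatives of |X| and of s never enter, so no formula for them is derived.\<close>

lemma pullback_wide_map: "pullback wide_map (wide_form i j) x v w = omega_std v w"
proof -
  define D where "D = frechet_derivative wide_map (at x)"
  define DX DE Dn Ds Dq Dy where "DX = frechet_derivative gnomonic_vec (at x)"
    and "DE = frechet_derivative covec (at x)"
    and "Dn = frechet_derivative (\<lambda>x. norm (gnomonic_vec x)) (at x)"
    and "Ds = frechet_derivative normal_part (at x)"
    and "Dq = frechet_derivative gnomonic (at x)"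
    and "Dy = frechet_derivative ambient (at x)"
  note der = smooth_on_has_derivative[OF _ UNIV_I]
  have D: "(wide_map has_derivative D) (at x)"
    and DX: "(gnomonic_vec has_derivative DX) (at x)"
    and DE: "(covec has_derivative DE) (at x)"
    and Dn: "((\<lambda>x. norm (gnomonic_vec x)) has_derivative Dn) (at x)"
    and Ds: "(normal_part has_derivative Ds) (at x)"
    and Dq: "(gnomonic has_derivative Dq) (at x)"
    and Dy: "(ambient has_derivative Dy) (at x)"
    unfolding D_def DX_def DE_def Dn_def Ds_def Dq_def Dy_def
    by (intro der smooth_wide_map smooth_gnomonic_vec smooth_covec smooth_norm_gnomonic_vec
        smooth_normal_part smooth_gnomonic smooth_ambient)+
  define X E n q s where "X = gnomonic_vec x" and "E = covec x" and "n = norm (gnomonic_vec x)"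
    and "q = gnomonic x" and "s = normal_part x"
  have n: "n > 0" unfolding n_def by (rule norm_gnomonic_vec_pos)
  have dq: "Dq u = (- (inverse n * Dn u * inverse n)) *\<^sub>R X + inverse n *\<^sub>R DX u" for u
  proof -
    have "((\<lambda>x. inverse (norm (gnomonic_vec x)) *\<^sub>R gnomonic_vec x) has_derivative
        (\<lambda>u. inverse n *\<^sub>R DX u + (- (inverse n * Dn u * inverse n)) *\<^sub>R X)) (at x)"
      using has_derivative_scaleR[OF Deriv.has_derivative_inverse[OF _ Dn] DX] n
      by (simp add: n_def X_def)
    from has_derivative_unique[OF Dq[unfolded gnomonic_def[abs_def]] this] show ?thesis
      by (simp add: add.commute)
  qed
  have dy: "Dy u = (Dn u *\<^sub>R E + n *\<^sub>R DE u) + (Ds u *\<^sub>R q + s *\<^sub>R Dq u)" for u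
  proof -
    note scale = has_derivative_scaleR[OF Dn DE] has_derivative_scaleR[OF Ds Dq]
    have "((\<lambda>x. norm (gnomonic_vec x) *\<^sub>R covec x + normal_part x *\<^sub>R gnomonic x) has_derivative
        (\<lambda>u. (n *\<^sub>R DE u + Dn u *\<^sub>R E) + (s *\<^sub>R Dq u + Ds u *\<^sub>R q))) (at x)"
      using has_derivative_add[OF scale] by (simp add: n_def E_def s_def q_def)
    from has_derivative_unique[OF Dy[unfolded ambient_def[abs_def] momentum_def] this] show ?thesis
      by (simp add: add.commute)
  qed
  have XE: "X \<bullet> E = 0" by (simp add: X_def E_def gnomonic_vec_orth)
  have XDE: "X \<bullet> DE u = - (E \<bullet> DX u)" for u
  proof -
    have "(\<lambda>u. X \<bullet> DE u + DX u \<bullet> E) = (\<lambda>u. 0)"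
      using has_derivative_inner[OF DX DE] unfolding gnomonic_vec_orth X_def[symmetric] E_def[symmetric]
      by (rule has_derivative_unique) (rule has_derivative_const)
    from fun_cong[OF this, of u] show ?thesis by (simp add: inner_commute)
  qed
  have qDq: "q \<bullet> Dq u = 0" for u
  proof -
    have "(\<lambda>u. q \<bullet> Dq u + Dq u \<bullet> q) = (\<lambda>u. 0)"
      using has_derivative_inner[OF Dq Dq] unfolding gnomonic_unit q_def[symmetric]
      by (rule has_derivative_unique) (rule has_derivative_const)
    from fun_cong[OF this, of u] show ?thesis by (simp add: inner_commute)
  qed
  have cotangent: "Dy v \<bullet> Dq w - Dy w \<bullet> Dq v = DE v \<bullet> DX w - DE w \<bullet> DX v"
  proof -
    have "(Dn v *\<^sub>R E + n *\<^sub>R DE v) \<bullet> Dq w = inverse n * (Dn v * (E \<bullet> DX w) + Dn w * (E \<bullet> DX v)) + DE v \<bullet> DX w"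
      for v w
    proof -
      have "n * inverse n = 1" "DE v \<bullet> X = - (E \<bullet> DX v)" "E \<bullet> X = 0"
        using n XE XDE[of v] by (simp_all add: inner_commute)
      moreover have "(Dn v *\<^sub>R E + n *\<^sub>R DE v) \<bullet> Dq w
        = Dn v * (- (inverse n * Dn w * inverse n) * (E \<bullet> X) + inverse n * (E \<bullet> DX w))
          + n * (- (inverse n * Dn w * inverse n) * (DE v \<bullet> X) + inverse n * (DE v \<bullet> DX w))"
        unfolding dq inner_add_left inner_add_right inner_scaleR_left inner_scaleR_right
        by algebra
      ultimately show ?thesis by algebra
    qed
    then have "Dy v \<bullet> Dq w = inverse n * (Dn v * (E \<bullet> DX w) + Dn w * (E \<bullet> DX v)) + DE v \<bullet> DX w
        + s * (Dq v \<bullet> Dq w)" for v w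
      unfolding dy using qDq by (simp add: inner_add_left)
    then show ?thesis by (simp add: inner_commute[of "Dq w" "Dq v"] algebra_simps)
  qed
  have comps: "DX u $ 1 = Im (u $ Some i)" "DX u $ 2 = Im (u $ Some j)" "DX u $ 3 = 0"
    "DE u $ 1 = Re (u $ Some i)" "DE u $ 2 = Re (u $ Some j)" for u
    by (rule has_derivative_linear_unique[OF DX bounded_linear_vec_nth]
          has_derivative_linear_unique[OF DE bounded_linear_vec_nth],
        simp add: gnomonic_vec_def covec_def coord_derivative)+
  have chart: "DE v \<bullet> DX w - DE w \<bullet> DX v
      = (Re (v $ Some i) * Im (w $ Some i) - Im (v $ Some i) * Re (w $ Some i))
        + (Re (v $ Some j) * Im (w $ Some j) - Im (v $ Some j) * Re (w $ Some j))"
    by (simp add: inner_vec_def sum_3 comps)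
  define a b k where "a = Re (x $ None)" and "b = Im (x $ None)" and "k = strip_scale x"
  have k: "k > 0" "k\<^sup>2 = 1 + a\<^sup>2" by (simp_all add: k_def a_def strip_scale_pos strip_scale_sq)
  have Dstrip: "(strip_scale has_derivative (\<lambda>u. a * Re (u $ None) * inverse k)) (at x)"
  proof -
    have "((\<lambda>x. 1 + (Re (x $ None))\<^sup>2) has_derivative (\<lambda>u. 2 * a * Re (u $ None))) (at x)"
      using has_derivative_add[OF has_derivative_const has_derivative_power[OF coord_derivative(1)[of None], where n = 2]]
      by (rule has_derivative_eq_rhs) (simp add: a_def fun_eq_iff)
    from has_derivative_real_sqrt[OF _ this] k(1) show ?thesis
      by (simp add: strip_scale_def[abs_def] k_def a_def add_pos_nonneg field_simps)
  qed
  have dh: "dheight i j (wide_map x) (D u) = Re (u $ None) * inverse k ^ 3" for u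
  proof (rule has_derivative_chain_unique[OF D height_has_derivative])
    have "k * inverse k = 1" using k(1) by simp
    then have "a * - (inverse k * (a * r * inverse k) * inverse k) + r * inverse k = r * inverse k ^ 3" for r
      using k(2) by algebra
    moreover have "((\<lambda>x. Re (x $ None) * inverse (strip_scale x)) has_derivative
        (\<lambda>u. a * - (inverse k * (a * Re (u $ None) * inverse k) * inverse k) + Re (u $ None) * inverse k)) (at x)"
      using has_derivative_mult[OF coord_derivative(1) Deriv.has_derivative_inverse[OF _ Dstrip]] k(1)
      by (simp add: k_def a_def)
    ultimately show "((\<lambda>x. height i j (wide_map x)) has_derivative (\<lambda>u. Re (u $ None) * inverse k ^ 3)) (at x)"
      by (simp add: height_wide_map)
  qed
  have dt: "Im (snd (D u) $ j) = Im (u $ None) * k ^ 3 + 3 * a * b * k * Re (u $ None)" for u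
  proof -
    have "((\<lambda>x. Im (x $ None) * strip_scale x ^ 3) has_derivative
        (\<lambda>u. b * (3 * (a * Re (u $ None) * inverse k) * k\<^sup>2) + Im (u $ None) * k ^ 3)) (at x)"
      using has_derivative_mult[OF coord_derivative(2) has_derivative_power[OF Dstrip, of 3]]
      by (simp add: b_def k_def)
    moreover have "b * (3 * (a * r * inverse k) * k\<^sup>2) + r' * k ^ 3 = r' * k ^ 3 + 3 * a * b * k * r" for r r'
      using k(1) by (simp add: power2_eq_square)
    ultimately show ?thesis
      using has_derivative_linear_unique[OF D bounded_linear_compose[OF bounded_linear_Im_nth bounded_linear_snd], of j]
      by (simp add: wide_map_simps)
  qed
  have strip_part: "dheight i j (wide_map x) (D v) * Im (snd (D w) $ j)
      - dheight i j (wide_map x) (D w) * Im (snd (D v) $ j)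
      = Re (v $ None) * Im (w $ None) - Im (v $ None) * Re (w $ None)"
  proof -
    have "inverse k ^ 3 * k ^ 3 = 1" using k(1) by (simp flip: power_mult_distrib)
    then show ?thesis unfolding dh dt by algebra
  qed
  have fD: "fst (D u) = Dq u" "yvec i j (snd (D u)) = Dy u" for u
    using has_derivative_linear_unique[OF D bounded_linear_fst] Dq
      has_derivative_linear_unique[OF D bounded_linear_yvec_snd[of i j]] Dy
    by (simp_all add: wide_map_simps)
  have rest: "snd (D u) $ l = u $ Some l" if "l \<noteq> i" "l \<noteq> j" for u l
  proof -
    have "((\<lambda>x. snd (wide_map x) $ l) has_derivative (\<lambda>u. u $ Some l)) (at x)"
      using that by (simp add: wide_map_simps bounded_linear_imp_has_derivative[OF bounded_linear_vec_nth])
    then show ?thesis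
      by (rule has_derivative_linear_unique[OF D bounded_linear_compose[OF bounded_linear_vec_nth bounded_linear_snd]])
  qed
  have "(\<Sum>l\<in>- {i, j}. Re (snd (D v) $ l) * Im (snd (D w) $ l) - Im (snd (D v) $ l) * Re (snd (D w) $ l))
    = (\<Sum>l\<in>- {i, j}. Re (v $ Some l) * Im (w $ Some l) - Im (v $ Some l) * Re (w $ Some l))"
    by (intro sum.cong) (auto simp: rest)
  then show ?thesis
    unfolding pullback_def D_def[symmetric] wide_form_def strip_part fD cotangent chart omega_std_def
    by (simp add: sum_option_split)
qed

text \<open>Here m recovers p, the tangential part of y, and a is recovered from s and p; the formula makes
sense, and is continuous, wherever q has positive third coordinate.\<close>

definition wide_map_inv :: "(real ^ 3) \<times> (complex ^ 'n) \<Rightarrow> complex ^ ('n option)" where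
  "wide_map_inv p = (let q = fst p; y = yvec i j (snd p); m = y - (q \<bullet> y) *\<^sub>R q;
       a = (q \<bullet> y) / sqrt (1 + m \<bullet> m)
     in \<chi> l. case l of None \<Rightarrow> Complex a (Im (snd p $ j) / sqrt (1 + a\<^sup>2) ^ 3)
       | Some k \<Rightarrow> if k = i then Complex (m $ 1 * q $ 3) (q $ 1 / q $ 3)
                 else if k = j then Complex (m $ 2 * q $ 3) (q $ 2 / q $ 3) else snd p $ k)"

lemma gnomonic_3_pos: "gnomonic x $ 3 > 0"
  using norm_gnomonic_vec_pos[of x] by (simp add: gnomonic_def gnomonic_vec_def)

lemma wide_map_inv: "wide_map_inv (wide_map x) = x"
proof -
  have m: "ambient x - normal_part x *\<^sub>R gnomonic x = momentum x"
    by (simp add: ambient_def)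
  have s: "sqrt (1 + momentum x \<bullet> momentum x) \<noteq> 0"
    by (metis add_pos_nonneg inner_ge_zero less_irrefl real_sqrt_eq_zero_cancel_iff zero_less_one)
  have a: "normal_part x / sqrt (1 + momentum x \<bullet> momentum x) = Re (x $ None)"
    using s by (simp add: normal_part_def)
  have b: "Im (x $ None) * strip_scale x ^ 3 / sqrt (1 + (Re (x $ None))\<^sup>2) ^ 3 = Im (x $ None)"
    using strip_scale_pos[of x] by (simp add: strip_scale_def)
  have n: "norm (gnomonic_vec x) \<noteq> 0" using norm_gnomonic_vec_pos[of x] by simp
  have 1: "momentum x $ 1 * gnomonic x $ 3 = Re (x $ Some i)" "momentum x $ 2 * gnomonic x $ 3 = Re (x $ Some j)"
    using n by (simp_all add: momentum_def gnomonic_def covec_def gnomonic_vec_def[of x, THEN arg_cong[of _ _ "\<lambda>v. v $ 3"]])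
  have 2: "gnomonic x $ 1 / gnomonic x $ 3 = Im (x $ Some i)" "gnomonic x $ 2 / gnomonic x $ 3 = Im (x $ Some j)"
    using n by (simp_all add: gnomonic_def) (simp_all add: gnomonic_vec_def)
  show ?thesis
    unfolding wide_map_inv_def wide_map_simps gnomonic_ambient m Let_def a
    using 1 2 b ij by (auto simp: vec_eq_iff wide_map_simps split: option.split)
qed

lemma continuous_on_wide_map_inv: "continuous_on {p. fst p $ 3 > 0} wide_map_inv"
proof -
  let ?T = "{p :: (real ^ 3) \<times> (complex ^ 'n). fst p $ 3 > 0}"
  have sq: "1 + c \<bullet> c \<noteq> 0" "1 + d\<^sup>2 \<noteq> 0" for c :: "real ^ 3" and d :: real
    using add_pos_nonneg[OF zero_less_one inner_ge_zero[of c]] add_pos_nonneg[OF zero_less_one zero_le_power2[of d]]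
    by simp_all
  have y: "continuous_on ?T (\<lambda>p. yvec i j (snd p))"
    by (rule linear_continuous_on[OF bounded_linear_yvec_snd])
  have m: "continuous_on ?T (\<lambda>p. yvec i j (snd p) - (fst p \<bullet> yvec i j (snd p)) *\<^sub>R fst p)"
    by (intro continuous_intros y)
  have a: "continuous_on ?T (\<lambda>p. (fst p \<bullet> yvec i j (snd p)) /
      sqrt (1 + (yvec i j (snd p) - (fst p \<bullet> yvec i j (snd p)) *\<^sub>R fst p)
        \<bullet> (yvec i j (snd p) - (fst p \<bullet> yvec i j (snd p)) *\<^sub>R fst p)))"
    by (intro continuous_intros y m) (simp add: sq)
  show ?thesis
    unfolding wide_map_inv_def Let_def
  proof (rule continuous_on_vec_lambda, goal_cases)
    case (1 l)
    show ?case
    proof (cases l)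
      case None
      then show ?thesis
        by simp (intro continuous_intros a; simp add: sq)
    next
      case (Some k)
      consider "k = i" | "k = j" | "k \<noteq> i" "k \<noteq> j" by blast
      then show ?thesis
        by cases (use Some ij in \<open>simp; intro continuous_intros y; simp\<close>)+
    qed
  qed
qed

text \<open>The map is an immersion because it pulls some form back to a nondegenerate one.\<close>

lemma symplectic_ball_embedding_wide_map:
  "symplectic_ball_embedding R S2_R2n (wide_form i j) wide_map"
proof -
  have open_b: "open (ball (0 :: complex ^ ('n option)) R)" by simp
  have sm: "smooth_on (ball 0 R) wide_map"
    using smooth_wide_map smooth_on_subset[OF _ subset_UNIV] by blast
  have nondeg: "inj (frechet_derivative wide_map (at x))" for x
  proof -
    let ?D = "frechet_derivative wide_map (at x)"
    have lin: "linear ?D"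
      using smooth_on_has_derivative[OF smooth_wide_map UNIV_I] has_derivative_linear by blast
    have "v = 0" if "?D v = 0" for v
    proof -
      have "omega_std v w = 0" for w
      proof -
        have "omega_std v w = wide_form i j (wide_map x) 0 (?D w)"
          using pullback_wide_map[of x v w] that by (simp add: pullback_def)
        also have "\<dots> = 0" by (rule bilinear_lzero[OF bilinear_wide_form])
        finally show ?thesis .
      qed
      from this[of "\<i> *s v"] have "v \<bullet> v = 0" by (simp only: omega_std_i)
      then show ?thesis by simp
    qed
    then show ?thesis using lin by (simp add: linear_injective_0)
  qed
  have "homeomorphism (ball 0 R) (wide_map ` ball 0 R) wide_map wide_map_inv"
  proof (rule homeomorphismI)
    show "continuous_on (ball 0 R) wide_map" by (rule smooth_on_imp_continuous_on[OF sm])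
    show "continuous_on (wide_map ` ball 0 R) wide_map_inv"
      by (rule continuous_on_subset[OF continuous_on_wide_map_inv]) (auto simp: wide_map_simps gnomonic_3_pos)
  qed (auto simp: wide_map_inv)
  moreover have "wide_map ` ball 0 R \<subseteq> S2_R2n"
    using gnomonic_unit by (auto simp: S2_R2n_def wide_map_def norm_eq_1)
  ultimately show ?thesis
    unfolding symplectic_ball_embedding_def smooth_embedding_def
    using sm nondeg pullback_wide_map by blast
qed

end
section \<open>Infinite Gromov width\<close>

lemma gromov_width_eq_infinity:
  assumes "\<And>R. R > 0 \<Longrightarrow> \<exists>f :: complex ^ 'm \<Rightarrow> 'a. symplectic_ball_embedding R X \<omega> f"
  shows "gromov_width TYPE('m::finite) (X :: 'a::euclidean_space set) \<omega> = \<infinity>"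
proof (rule ccontr)
  let ?w = "gromov_width TYPE('m) X \<omega>"
  assume "?w \<noteq> \<infinity>"
  then obtain r where r: "r \<ge> 0" "?w = ennreal r"
    by (cases ?w) auto
  have "ennreal (pi * (1 + r)\<^sup>2) \<le> ?w"
    unfolding gromov_width_def using assms[of "1 + r"] r(1) by (intro Sup_upper) auto
  then have "pi * (1 + r)\<^sup>2 \<le> r"
    using r by (simp add: ennreal_le_iff)
  moreover have "1 * (1 + r)\<^sup>2 \<le> pi * (1 + r)\<^sup>2"
    using pi_gt3 by (intro mult_right_mono) auto
  moreover have "r < (1 + r)\<^sup>2"
    using r(1) by (simp add: power2_eq_square algebra_simps add_strict_increasing)
  ultimately show False by linarith
qed

text \<open>The index type \<open>'n option\<close> supplies the coordinates of \<complex>^(n + 1): those of \<open>Some i\<close> and \<open>Some j\<close>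
parametrize the cotangent bundle of a hemisphere, those of \<open>None\<close> the strip.\<close>

theorem theorem2:
  fixes \<sigma> :: "(real ^ 3) form2"
  assumes "CARD('n::finite) \<ge> 2"
    and "unit_area_form \<sigma>"
  shows "\<exists>\<omega> :: ((real ^ 3) \<times> (complex ^ 'n)) form2.
           symplectic_form S2_R2n \<omega> \<and>
           \<bar>comass S2_R2n (g0 \<sigma>) (\<lambda>p v w. \<omega> p v w - omega0 \<sigma> p v w)\<bar> \<noteq> \<infinity> \<and>
           gromov_width TYPE('n option) S2_R2n \<omega> = \<infinity>"
proof -
  \<comment> \<open>Two distinct complex coordinates are what the construction consumes.\<close>
  obtain i j :: 'n where ij: "i \<noteq> j"
    using obtain_subset_with_card_n[OF assms(1)] by (metis card_2_iff)
  obtain C where C: "C \<ge> 0"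
    "\<And>p v w. p \<in> S2_R2n \<Longrightarrow> \<bar>wide_form i j p v w\<bar> \<le> C * norm v * norm w"
    using wide_form_bounded[of i j] by blast
  have alt: "wide_form i j p v v = 0" for p v
    by (simp add: wide_form_def)
  have \<sigma>: "smooth_form2 S2 \<sigma>" "compatible_S2 \<sigma>"
    using assms(2) by (simp_all add: unit_area_form_def symplectic_form_def)
  have "symplectic_form S2_R2n (wide_form i j)"
    by (rule symplectic_wide_form[OF ij])
  moreover have "\<bar>comass S2_R2n (g0 \<sigma>) (\<lambda>p v w. wide_form i j p v w - omega0 \<sigma> p v w)\<bar> \<noteq> \<infinity>"
    by (rule comass_diff_omega0_finite[OF \<sigma> bilinear_wide_form alt C(2,1)])
  moreover have "gromov_width TYPE('n option) S2_R2n (wide_form i j) = \<infinity>"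
    using symplectic_ball_embedding_wide_map[OF ij] by (intro gromov_width_eq_infinity) blast
  ultimately show ?thesis by (intro exI[of _ "wide_form i j"] conjI)
qed

end
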